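(* Let $(M,\widetilde B)$ be a strict root of unity quantum seed with respect to a skew-symmetric integer matrix $\Lambda$, $(M_q,\widetilde B)$ the associated quantum seed, and $\mathrm{inv}\subseteq[1,N]\setminus\mathrm{ex}$. If $\mathcal A_q(M_q,\widetilde B,\mathrm{inv})=\mathcal U_q(M_q,\widetilde B,\mathrm{inv})$, then $\mathcal A_q(M_q,\widetilde B,\mathrm{inv})/(\Phi_\ell(q^{1/2}))\cong\mathcal A_\varepsilon(M,\widetilde B,\mathrm{inv})$, and the specialization map $\eta_\varepsilon:\mathcal A_q(M_q,\widetilde B,\mathrm{inv})\to\mathcal A_q(M_q,\widetilde B,\mathrm{inv})/(\Phi_\ell(q^{1/2}))$ is the restriction to $\mathcal A_q(M_q,\widetilde B,\mathrm{inv})$ of the specialization map $\kappa_\varepsilon:\mathcal T_q(M_q)_\ge\to\mathcal T_\varepsilon(M)_\ge$.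
   Context: Root of unity setting: $\ell$ a positive integer, $\mathbb Z_\ell=\mathbb Z/\ell\mathbb Z$, $\varepsilon^{1/2}\in\mathbb C$ a primitive $\ell$-th root of unity, $\mathcal A^{1/2}_\varepsilon=\mathbb Z[\varepsilon^{1/2}]$, $\varepsilon^{a/2}=(\varepsilon^{1/2})^a$; $\overline C$ = reduction mod $\ell$; $e_1,\dots,e_N$ standard basis. For skew-symmetric $\Lambda:\mathbb Z^N\times\mathbb Z^N\to\mathbb Z_\ell$, $\mathcal T_\varepsilon(\Lambda)$ has $\mathcal A^{1/2}_\varepsilon$-basis $X^f$ with $X^fX^g=\varepsilon^{\Lambda(f,g)/2}X^{f+g}$; a root of unity toric frame of a division algebra $\mathcal F$ over $\mathbb Q(\varepsilon^{1/2})$ is $M:\mathbb Z^N\to\mathcal F$ with $f\mapsto M(f)$ extending to an injective algebra map from some (unique) $\mathcal T_\varepsilon(\Lambda_M)$ whose image $\mathcal T_\varepsilon(M)$ generates $\mathcal F$ as a skew field. Fix $\mathrm{ex}\subseteq[1,N]$; $\widetilde B=(b_{ij})$ integer, rows $[1,N]$, columns $\mathrm{ex}$, principal part $B$, columns $b^k$. $\ell$-compatibility w.r.t. $D=\mathrm{diag}(d_j)_{j\in\mathrm{ex}}$ ($d_j>0$): $DB$ skew-symmetric and $\sum_k\overline b_{kj}(\Lambda_M)_{ki}=\delta_{ij}\overline d_j$ mod $\ell$; seeds are such pairs; mutation $\mu_k$: $\mu_k(\widetilde B)$ has entries $-b_{ij}$ if $i=k$ or $j=k$, else $b_{ij}+(|b_{ik}|b_{kj}+b_{ik}|b_{kj}|)/2$;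 $\mu_k(M)$ is the frame with matrix $\overline E^\top\Lambda_M\overline E$ ($e_{ij}=\delta_{ij}$ for $j\ne k$, $e_{kk}=-1$, $e_{ik}=\max(0,-b_{ik})$), $\mu_k(M)(e_j)=M(e_j)$ ($j\ne k$), $\mu_k(M)(e_k)=M(-e_k+[b^k]_+)+M(-e_k-[b^k]_-)$ ($[b]_\pm$ keeps entries with $\pm b_i\ge0$). $\mathcal A_\varepsilon(M,\widetilde B,\mathrm{inv})$ is the $\mathcal A^{1/2}_\varepsilon$-algebra generated by all cluster variables $M'(e_i)$ of mutation-equivalent seeds and $M(e_j)^{-1}$, $j\in\mathrm{inv}$. Quantum setting: $\mathcal A^{1/2}_q=\mathbb Z[q^{\pm1/2}]$; $\mathcal T_q(\Lambda)$ for skew-symmetric integer $\Lambda$ has basis $X^f$ with $X^fX^g=q^{\Lambda(f,g)/2}X^{f+g}$; toric frames $M_q$, compatibility ($\sum_kb_{kj}\lambda_{ki}=\delta_{ij}d_j$), quantum seeds, mutations and $\mathcal A_q(M_q,\widetilde B,\mathrm{inv})$ are defined analogously over $\mathcal A^{1/2}_q$; $\mathcal U_q(M_q,\widetilde B,\mathrm{inv})$ is the intersection over all quantum seeds $(M'_q,\widetilde B')$ mutation-equivalent to $(M_q,\widetilde B)$ of $\mathcal T_q(M'_q)_\ge$, where $\mathcal T_q(M'_q)_\ge$ is the subalgebra generated by $M'_q(e_i)$, $i\in[1,N]$, and $M'_q(e_j)^{-1}$, $j\in\mathrm{ex}\sqcup\mathrm{inv}$; $\mathcal T_\varepsilon(M)_\ge$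 is defined likewise. Strictness: $(M,\widetilde B)$ is strict w.r.t. skew-symmetric $\Lambda\in M_N(\mathbb Z)$ if $\overline\Lambda=\Lambda_M$ and $(\Lambda,\widetilde B)$ is compatible w.r.t. the same $D$; the associated quantum seed is $(M_q,\widetilde B)$ in $\mathrm{Fract}(\mathcal T_q(\Lambda))$ with $M_q(f)=X^f$. $\Phi_\ell$ is the $\ell$-th cyclotomic polynomial; $\kappa_\varepsilon:\mathcal T_q(M_q)_\ge\to\mathcal T_\varepsilon(M)_\ge$ is the ring surjection $q^{1/2}\mapsto\varepsilon^{1/2}$, $M_q(f)\mapsto M(f)$, with kernel $(\Phi_\ell(q^{1/2}))$. *)

theory Defs
  imports Complex_Main "HOL-Computational_Algebra.Polynomial"
begin

definition zvec :: "nat \<Rightarrow> (nat \<Rightarrow> int) set" where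
  "zvec N = {f. \<forall>i. i \<notin> {1..N} \<longrightarrow> f i = 0}"

definition unitv :: "nat \<Rightarrow> nat \<Rightarrow> int" where
  "unitv k = (\<lambda>i. if i = k then 1 else 0)"

definition bform :: "nat \<Rightarrow> (nat \<Rightarrow> nat \<Rightarrow> int) \<Rightarrow> (nat \<Rightarrow> int) \<Rightarrow> (nat \<Rightarrow> int) \<Rightarrow> int" where
  "bform N lam f g = (\<Sum>i\<in>{1..N}. \<Sum>j\<in>{1..N}. f i * lam i j * g j)"

definition skew_int :: "nat \<Rightarrow> (nat \<Rightarrow> nat \<Rightarrow> int) \<Rightarrow> bool" where
  "skew_int N lam = (\<forall>i\<in>{1..N}. \<forall>j\<in>{1..N}. lam i j = - lam j i)"

definition cyclotomic_c :: "nat \<Rightarrow> complex poly" where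
  "cyclotomic_c n = (\<Prod>k\<in>{k\<in>{1..n}. coprime k n}. [:- cis (2 * pi * real k / real n), 1:])"

definition cyclotomic :: "nat \<Rightarrow> int poly" where
  "cyclotomic n = map_poly (\<lambda>a. round (Re a)) (cyclotomic_c n)"

definition ipoly :: "int poly \<Rightarrow> 'a::ring_1 \<Rightarrow> 'a" where
  "ipoly p c = (\<Sum>i\<le>degree p. of_int (coeff p i) * c ^ i)"

inductive_set subring_gen :: "'a::ring_1 set \<Rightarrow> 'a set" for S where
  gen: "x \<in> S \<Longrightarrow> x \<in> subring_gen S"
| one: "1 \<in> subring_gen S"
| add: "x \<in> subring_gen S \<Longrightarrow> y \<in> subring_gen S \<Longrightarrow> x + y \<in> subring_gen S"
| neg: "x \<in> subring_gen S \<Longrightarrow> - x \<in> subring_gen S"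
| mult: "x \<in> subring_gen S \<Longrightarrow> y \<in> subring_gen S \<Longrightarrow> x * y \<in> subring_gen S"

definition div_closure :: "'a::division_ring set \<Rightarrow> 'a set" where
  "div_closure S = \<Inter>{R. S \<subseteq> R \<and> 1 \<in> R \<and> (\<forall>x\<in>R. \<forall>y\<in>R. x + y \<in> R \<and> x * y \<in> R)
                         \<and> (\<forall>x\<in>R. - x \<in> R \<and> inverse x \<in> R)}"

definition central :: "'a::ring_1 \<Rightarrow> bool" where
  "central c = (\<forall>y. c * y = y * c)"

text \<open>Quantum toric frame over Z[c^(+-1/2)] with c = q^(1/2): X^f X^g = c^(Lambda(f,g)) X^(f+g),
  injective extension of the quantum torus (linear independence over Z[c^(+-1)], which also forces
  c to be transcendental), generating the division ring.\<close>
definition q_toric_frame :: "nat \<Rightarrow> 'a::division_ring \<Rightarrow> (nat \<Rightarrow> nat \<Rightarrow> int) \<Rightarrow> ((nat \<Rightarrow> int) \<Rightarrow> 'a) \<Rightarrow> bool" where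
  "q_toric_frame N c lam X =
    ((\<forall>f\<in>zvec N. \<forall>g\<in>zvec N. X f * X g = power_int c (bform N lam f g) * X (\<lambda>i. f i + g i)) \<and>
     (\<forall>S p. finite S \<longrightarrow> S \<subseteq> zvec N \<longrightarrow> (\<Sum>f\<in>S. ipoly (p f) c * X f) = 0 \<longrightarrow> (\<forall>f\<in>S. p f = 0)) \<and>
     div_closure ({c, inverse c} \<union> X ` zvec N) = UNIV)"

text \<open>Root of unity toric frame over Z[z], z = eps^(1/2); Lambda is an integer lift of the
  Z_ell-valued form (only its class mod ell matters since z^ell = 1).\<close>
definition eps_toric_frame :: "nat \<Rightarrow> 'a::division_ring \<Rightarrow> (nat \<Rightarrow> nat \<Rightarrow> int) \<Rightarrow> ((nat \<Rightarrow> int) \<Rightarrow> 'a) \<Rightarrow> bool" where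
  "eps_toric_frame N z lam M =
    ((\<forall>f\<in>zvec N. \<forall>g\<in>zvec N. M f * M g = power_int z (bform N lam f g) * M (\<lambda>i. f i + g i)) \<and>
     (\<forall>S p. finite S \<longrightarrow> S \<subseteq> zvec N \<longrightarrow> (\<Sum>f\<in>S. ipoly (p f) z * M f) = 0 \<longrightarrow> (\<forall>f\<in>S. ipoly (p f) z = 0)) \<and>
     div_closure ({z, inverse z} \<union> M ` zvec N) = UNIV)"

definition compatible :: "nat \<Rightarrow> nat set \<Rightarrow> (nat \<Rightarrow> nat \<Rightarrow> int) \<Rightarrow> (nat \<Rightarrow> nat \<Rightarrow> int) \<Rightarrow> (nat \<Rightarrow> int) \<Rightarrow> bool" where
  "compatible N ex B lam d =
    ((\<forall>j\<in>ex. d j > 0) \<and> (\<forall>i\<in>ex. \<forall>j\<in>ex. d i * B i j = - (d j * B j i)) \<and>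
     (\<forall>j\<in>ex. \<forall>i\<in>{1..N}. (\<Sum>k\<in>{1..N}. B k j * lam k i) = (if i = j then d j else 0)))"

definition ell_compatible :: "nat \<Rightarrow> nat \<Rightarrow> nat set \<Rightarrow> (nat \<Rightarrow> nat \<Rightarrow> int) \<Rightarrow> (nat \<Rightarrow> nat \<Rightarrow> int) \<Rightarrow> (nat \<Rightarrow> int) \<Rightarrow> bool" where
  "ell_compatible ell N ex B lam d =
    ((\<forall>j\<in>ex. d j > 0) \<and> (\<forall>i\<in>ex. \<forall>j\<in>ex. d i * B i j = - (d j * B j i)) \<and>
     (\<forall>j\<in>ex. \<forall>i\<in>{1..N}. (\<Sum>k\<in>{1..N}. B k j * lam k i) mod int ell = (if i = j then d j else 0) mod int ell))"

text \<open>Value of the frame determined by the cluster x(1..N) and matrix lam: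
  M(f) = c^(- sum_{i<j} lam_ij f_i f_j) x_1^f_1 ... x_N^f_N (ordered product).\<close>
definition oprod :: "nat \<Rightarrow> (nat \<Rightarrow> 'a::division_ring) \<Rightarrow> (nat \<Rightarrow> int) \<Rightarrow> 'a" where
  "oprod N x f = foldr (\<lambda>i acc. power_int (x i) (f i) * acc) [1..<Suc N] 1"

definition frame_val :: "nat \<Rightarrow> 'a::division_ring \<Rightarrow> (nat \<Rightarrow> nat \<Rightarrow> int) \<Rightarrow> (nat \<Rightarrow> 'a) \<Rightarrow> (nat \<Rightarrow> int) \<Rightarrow> 'a" where
  "frame_val N c lam x f =
     power_int c (- (\<Sum>i\<in>{1..N}. \<Sum>j\<in>{i<..N}. lam i j * f i * f j)) * oprod N x f"

definition mutB :: "nat \<Rightarrow> (nat \<Rightarrow> nat \<Rightarrow> int) \<Rightarrow> (nat \<Rightarrow> nat \<Rightarrow> int)" where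
  "mutB k B = (\<lambda>i j. if i = k \<or> j = k then - B i j
                      else B i j + (\<bar>B i k\<bar> * B k j + B i k * \<bar>B k j\<bar>) div 2)"

definition mutE :: "nat \<Rightarrow> (nat \<Rightarrow> nat \<Rightarrow> int) \<Rightarrow> (nat \<Rightarrow> nat \<Rightarrow> int)" where
  "mutE k B = (\<lambda>i j. if j \<noteq> k then (if i = j then 1 else 0)
                      else if i = k then -1 else max 0 (- B i k))"

definition mutLam :: "nat \<Rightarrow> nat \<Rightarrow> (nat \<Rightarrow> nat \<Rightarrow> int) \<Rightarrow> (nat \<Rightarrow> nat \<Rightarrow> int) \<Rightarrow> (nat \<Rightarrow> nat \<Rightarrow> int)" where
  "mutLam N k B lam = (\<lambda>i j. \<Sum>a\<in>{1..N}. \<Sum>b\<in>{1..N}. mutE k B a i * lam a b * mutE k B b j)"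

definition bpos :: "nat \<Rightarrow> (nat \<Rightarrow> nat \<Rightarrow> int) \<Rightarrow> nat \<Rightarrow> (nat \<Rightarrow> int)" where
  "bpos N B k = (\<lambda>i. if i \<in> {1..N} then max 0 (B i k) else 0)"

definition bneg :: "nat \<Rightarrow> (nat \<Rightarrow> nat \<Rightarrow> int) \<Rightarrow> nat \<Rightarrow> (nat \<Rightarrow> int)" where
  "bneg N B k = (\<lambda>i. if i \<in> {1..N} then min 0 (B i k) else 0)"

definition mutX :: "nat \<Rightarrow> 'a::division_ring \<Rightarrow> (nat \<Rightarrow> nat \<Rightarrow> int) \<Rightarrow> (nat \<Rightarrow> nat \<Rightarrow> int) \<Rightarrow> nat
                    \<Rightarrow> (nat \<Rightarrow> 'a) \<Rightarrow> (nat \<Rightarrow> 'a)" where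
  "mutX N c lam B k x = x(k := frame_val N c lam x (\<lambda>i. - unitv k i + bpos N B k i)
                             + frame_val N c lam x (\<lambda>i. - unitv k i - bneg N B k i))"

type_synonym 'a seed = "(nat \<Rightarrow> 'a) \<times> (nat \<Rightarrow> nat \<Rightarrow> int) \<times> (nat \<Rightarrow> nat \<Rightarrow> int)"

text \<open>A seed is recorded as (cluster x_i = M(e_i), matrix of Lambda_M, exchange matrix).\<close>
definition mutseed :: "nat \<Rightarrow> 'a::division_ring \<Rightarrow> nat \<Rightarrow> 'a seed \<Rightarrow> 'a seed" where
  "mutseed N c k s = (case s of (x, lam, B) \<Rightarrow> (mutX N c lam B k x, mutLam N k B lam, mutB k B))"

inductive_set seeds :: "nat \<Rightarrow> 'a::division_ring \<Rightarrow> nat set \<Rightarrow> 'a seed \<Rightarrow> 'a seed set"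
  for N c ex s0 where
  init: "s0 \<in> seeds N c ex s0"
| step: "s \<in> seeds N c ex s0 \<Longrightarrow> k \<in> ex \<Longrightarrow> mutseed N c k s \<in> seeds N c ex s0"

definition clalg :: "nat \<Rightarrow> 'a::division_ring \<Rightarrow> nat set \<Rightarrow> nat set \<Rightarrow> 'a seed \<Rightarrow> 'a set" where
  "clalg N c ex iv s0 = subring_gen ({c, inverse c}
      \<union> {fst s i | s i. s \<in> seeds N c ex s0 \<and> i \<in> {1..N}}
      \<union> {inverse (fst s0 j) | j. j \<in> iv})"

definition Tge :: "nat \<Rightarrow> 'a::division_ring \<Rightarrow> nat set \<Rightarrow> nat set \<Rightarrow> (nat \<Rightarrow> 'a) \<Rightarrow> 'a set" where
  "Tge N c ex iv x = subring_gen ({c, inverse c} \<union> x ` {1..N} \<union> (\<lambda>j. inverse (x j)) ` (ex \<union> iv))"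

definition upper :: "nat \<Rightarrow> 'a::division_ring \<Rightarrow> nat set \<Rightarrow> nat set \<Rightarrow> 'a seed \<Rightarrow> 'a set" where
  "upper N c ex iv s0 = (\<Inter>s\<in>seeds N c ex s0. Tge N c ex iv (fst s))"

end

theory Submission
  imports Defs
begin

text \<open>
  The elements \<open>q^(1/2)\<close> and \<open>\<epsilon>^(1/2)\<close> are treated alike, as a central unit \<open>c\<close> of a division ring. A seed whose
  cluster quasi-commutes, whose pair \<open>(\<Lambda>, B)\<close> is compatible, and whose Laurent monomials are linearly
  independent over \<open>\<int>[c^\<plusminus>1]\<close> keeps these properties under mutation. Independence survives because the new
  variable is homogeneous of degree \<open>-1\<close> in the old \<open>x k\<close>, so a relation splits into graded pieces, each of
  which is a relation between old monomials.

  Since \<open>\<A> = \<U>\<close>, all quantum cluster variables lie in the domain of \<open>\<kappa>\<close>, and the exchange relations show that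
  \<open>\<kappa>\<close> sends them to the corresponding root of unity cluster variables; this gives the image. For the kernel,
  let \<open>a \<in> \<A>\<close> with \<open>\<kappa> a = 0\<close>, so \<open>a = \<Phi> b\<close> with \<open>b\<close> in the initial mixed quantum torus. In every other seed,
  expand \<open>a\<close> into Laurent monomials, clear denominators by a monomial and apply \<open>\<kappa>\<close>: independence on the root
  of unity side forces \<open>\<kappa>\<close> to kill every coefficient, hence every coefficient is divisible by \<open>\<Phi>\<close>. This last
  divisibility is read off from the known kernel of \<open>\<kappa>\<close>, so irreducibility of \<open>\<Phi>\<close> is not needed. Thus \<open>b\<close> lies
  in the mixed quantum torus of every seed, that is, in \<open>\<U> = \<A>\<close>.
\<close>

section \<open>Generated subrings and their images\<close>

lemma subring_gen_zero: "0 \<in> subring_gen S"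
  using subring_gen.add[OF subring_gen.one subring_gen.neg[OF subring_gen.one]] by simp

lemma subring_gen_diff: "x \<in> subring_gen S \<Longrightarrow> y \<in> subring_gen S \<Longrightarrow> x - y \<in> subring_gen S"
  using subring_gen.add[OF _ subring_gen.neg] by fastforce

lemma subring_gen_sum: "(\<And>i. i \<in> I \<Longrightarrow> h i \<in> subring_gen S) \<Longrightarrow> sum h I \<in> subring_gen S"
  by (induction I rule: infinite_finite_induct) (auto intro: subring_gen.add subring_gen_zero)

lemma subring_gen_power: "x \<in> subring_gen S \<Longrightarrow> x ^ n \<in> subring_gen S"
  by (induction n) (auto intro: subring_gen.mult subring_gen.one)

lemma subring_gen_power_int:
  fixes x :: "'a::division_ring"
  shows "x \<in> subring_gen S \<Longrightarrow> n \<ge> 0 \<or> inverse x \<in> subring_gen S \<Longrightarrow> x powi n \<in> subring_gen S"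
  by (auto simp: power_int_def intro: subring_gen_power)

lemma subring_gen_of_int: "of_int n \<in> subring_gen S"
proof -
  have "of_nat m \<in> subring_gen S" for m
    by (induction m) (auto intro: subring_gen.add subring_gen_zero subring_gen.one)
  then show ?thesis
    by (cases n) (auto intro: subring_gen.neg simp del: of_nat_Suc)
qed

lemma subring_gen_least:
  assumes "S \<subseteq> subring_gen T"
  shows "subring_gen S \<subseteq> subring_gen T"
proof
  fix x assume "x \<in> subring_gen S"
  then show "x \<in> subring_gen T"
    using assms by induction (auto intro: subring_gen.intros)
qed

lemma subring_gen_ipoly: "x \<in> subring_gen S \<Longrightarrow> ipoly p x \<in> subring_gen S"
  unfolding ipoly_def
  by (intro subring_gen_sum subring_gen.mult subring_gen_of_int subring_gen_power)

text \<open>The function \<open>\<kappa>\<close> is controlled only on the generated subring, so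
  compatibility with zero and negation has to be derived from additivity there before the inductions
  over generation can run.\<close>

lemma image_subring_gen:
  assumes hom: "\<And>a b. a \<in> subring_gen S \<Longrightarrow> b \<in> subring_gen S \<Longrightarrow>
                  \<kappa> (a + b) = \<kappa> a + \<kappa> b \<and> \<kappa> (a * b) = \<kappa> a * \<kappa> b"
    and one: "\<kappa> 1 = 1"
  shows "\<kappa> ` subring_gen S = subring_gen (\<kappa> ` S)"
proof -
  have "\<kappa> 0 = 0"
    using hom[OF subring_gen_zero subring_gen_zero] by simp
  then have kneg: "\<kappa> (- a) = - \<kappa> a" if "a \<in> subring_gen S" for a
    using hom[OF that subring_gen.neg[OF that]] by (simp add: eq_neg_iff_add_eq_0 add.commute)
  show ?thesis
  proof (intro equalityI subsetI)
    fix y assume "y \<in> \<kappa> ` subring_gen S"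
    then obtain x where "x \<in> subring_gen S" "y = \<kappa> x" by auto
    moreover have "\<kappa> x \<in> subring_gen (\<kappa> ` S)" if "x \<in> subring_gen S" for x
      using that by induction (auto simp: hom one kneg intro: subring_gen.intros)
    ultimately show "y \<in> subring_gen (\<kappa> ` S)" by simp
  next
    fix y assume "y \<in> subring_gen (\<kappa> ` S)"
    then show "y \<in> \<kappa> ` subring_gen S"
    proof induction
      case (add x y)
      then obtain a b where "a \<in> subring_gen S" "b \<in> subring_gen S" "x = \<kappa> a" "y = \<kappa> b" by blast
      then show ?case by (intro image_eqI[of _ _ "a + b"]) (auto simp: hom intro: subring_gen.add)
    next
      case (mult x y)
      then obtain a b where "a \<in> subring_gen S" "b \<in> subring_gen S" "x = \<kappa> a" "y = \<kappa> b" by blast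
      then show ?case by (intro image_eqI[of _ _ "a * b"]) (auto simp: hom intro: subring_gen.mult)
    next
      case (neg x)
      then obtain a where "a \<in> subring_gen S" "x = \<kappa> a" by blast
      then show ?case by (intro image_eqI[of _ _ "- a"]) (auto simp: kneg intro: subring_gen.neg)
    next
      case one
      from \<open>\<kappa> 1 = 1\<close> show ?case by (intro image_eqI[of _ _ 1]) (auto intro: subring_gen.one)
    qed (auto intro: subring_gen.gen)
  qed
qed

section \<open>Exponent vectors and the bilinear form\<close>

lemma zvec_zero [simp]: "(\<lambda>i. 0) \<in> zvec N"
  by (simp add: zvec_def)

lemma zvec_add [intro]: "f \<in> zvec N \<Longrightarrow> g \<in> zvec N \<Longrightarrow> (\<lambda>i. f i + g i) \<in> zvec N"
  by (simp add: zvec_def)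

lemma zvec_uminus [intro]: "f \<in> zvec N \<Longrightarrow> (\<lambda>i. - f i) \<in> zvec N"
  by (simp add: zvec_def)

lemma zvec_unitv [intro]: "k \<in> {1..N} \<Longrightarrow> unitv k \<in> zvec N"
  by (auto simp: zvec_def unitv_def)

lemma bform_add_left: "bform N lam (\<lambda>i. f i + g i) h = bform N lam f h + bform N lam g h"
  by (simp add: bform_def algebra_simps sum.distrib)

lemma bform_uminus_left: "bform N lam (\<lambda>i. - f i) g = - bform N lam f g"
  by (simp add: bform_def sum_negf)

lemma bform_scale_left: "bform N lam (\<lambda>i. a * f i) g = a * bform N lam f g"
  by (simp add: bform_def sum_distrib_left algebra_simps)

lemma bform_scale_right: "bform N lam f (\<lambda>i. a * g i) = a * bform N lam f g"
  by (simp add: bform_def sum_distrib_left algebra_simps)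

lemma bform_zero_left [simp]: "bform N lam (\<lambda>i. 0) g = 0"
  by (simp add: bform_def)

lemma bform_skew:
  assumes "skew_int N lam"
  shows "bform N lam f g = - bform N lam g f"
proof -
  have "bform N lam f g = (\<Sum>j\<in>{1..N}. \<Sum>i\<in>{1..N}. f i * lam i j * g j)"
    unfolding bform_def by (rule sum.swap)
  also have "\<dots> = (\<Sum>j\<in>{1..N}. \<Sum>i\<in>{1..N}. - (g j * lam j i * f i))"
    using assms unfolding skew_int_def by (intro sum.cong refl) (metis minus_mult_left minus_mult_right mult.commute mult.left_commute)
  also have "\<dots> = - bform N lam g f"
    unfolding bform_def by (simp add: sum_negf)
  finally show ?thesis .
qed

lemma bform_self [simp]: "skew_int N lam \<Longrightarrow> bform N lam f f = 0"
  using bform_skew[of N lam f f] by simp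

lemma bform_unitv_right:
  assumes "j \<in> {1..N}"
  shows "bform N lam f (unitv j) = (\<Sum>i\<in>{1..N}. f i * lam i j)"
  using assms by (simp add: bform_def unitv_def if_distrib[of "\<lambda>x. _ * x"] cong: if_cong)

lemma bform_unitv_unitv:
  assumes "i \<in> {1..N}" "j \<in> {1..N}"
  shows "bform N lam (unitv i) (unitv j) = lam i j"
  unfolding bform_unitv_right[OF assms(2)]
  using assms(1) by (simp add: unitv_def if_distrib[of "\<lambda>x. x * _"] cong: if_cong)

text \<open>Peels off the last coordinate in step with \<open>frame_val_Suc\<close>. Skewness makes
  the corner entry zero and the last row the negative of the last column, so one linear functional
  describes both cross terms.\<close>

lemma bform_Suc:
  assumes "skew_int (Suc n) lam"
  shows "bform (Suc n) lam f g = bform n lam f g + (\<Sum>i\<in>{1..n}. lam i (Suc n) * f i) * g (Suc n)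
           - f (Suc n) * (\<Sum>i\<in>{1..n}. lam i (Suc n) * g i)"
proof -
  have skew: "lam i j = - lam j i" if "i \<in> {1..Suc n}" "j \<in> {1..Suc n}" for i j
    using assms that unfolding skew_int_def by blast
  have *: "lam (Suc n) (Suc n) = 0" "\<And>i. i \<in> {1..n} \<Longrightarrow> lam (Suc n) i = - lam i (Suc n)"
    using skew[of "Suc n" "Suc n"] by (simp, intro skew) auto
  have "(\<Sum>j\<in>{1..n}. f (Suc n) * lam (Suc n) j * g j) = - (f (Suc n) * (\<Sum>i\<in>{1..n}. lam i (Suc n) * g i))"
    unfolding sum_distrib_left sum_negf[symmetric] by (intro sum.cong) (auto simp: *(2))
  then show ?thesis
    by (simp add: bform_def * sum.distrib sum_distrib_left sum_distrib_right algebra_simps)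
qed

section \<open>Ordered products of powers\<close>

lemma oprod_0 [simp]: "oprod 0 x f = 1"
  by (simp add: oprod_def)

text \<open>The definition consumes the product from the left, while inductions on the number of
  variables append a factor on the right; the auxiliary fact pulls the start value of the fold out
  as that factor.\<close>

lemma oprod_Suc: "oprod (Suc n) x f = oprod n x f * x (Suc n) powi f (Suc n)"
proof -
  have "foldr (\<lambda>i acc. x i powi f i * acc) xs (a::'a) = foldr (\<lambda>i acc. x i powi f i * acc) xs 1 * a" for xs a
    by (induction xs) (auto simp: mult.assoc)
  from this[of "[1..<Suc n]" "x (Suc n) powi f (Suc n)"] show ?thesis
    unfolding oprod_def by (simp del: upt_Suc add: upt_Suc_append)
qed

text \<open>Comparing powers instead of bases lets the two families differ at every index with
  exponent zero, which is the situation before and after a mutation.\<close>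

lemma oprod_cong:
  assumes "\<And>i. i \<in> {1..n} \<Longrightarrow> x i powi f i = y i powi g i"
  shows "oprod n x f = oprod n y g"
  using assms by (induction n) (auto simp: oprod_Suc)

lemma oprod_mem_subring_gen:
  assumes "\<And>i. i \<in> {1..n} \<Longrightarrow> x i \<in> subring_gen S"
    and "\<And>i. i \<in> {1..n} \<Longrightarrow> f i \<ge> 0 \<or> inverse (x i) \<in> subring_gen S"
  shows "oprod n x f \<in> subring_gen S"
  using assms by (induction n) (auto simp: oprod_Suc intro!: subring_gen.one subring_gen.mult subring_gen_power_int)

lemma upper_triangle_sum_Suc:
  "(\<Sum>i\<in>{1..Suc n}. \<Sum>j\<in>{i<..Suc n}. h i j) = (\<Sum>i\<in>{1..n}. \<Sum>j\<in>{i<..n}. h i j) + (\<Sum>i\<in>{1..n}. h i (Suc n) :: int)"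
proof -
  have "(\<Sum>j\<in>{i<..Suc n}. h i j) = (\<Sum>j\<in>{i<..n}. h i j) + h i (Suc n)" if "i \<in> {1..n}" for i
  proof -
    have "{i<..Suc n} = insert (Suc n) {i<..n}" using that by auto
    then show ?thesis by simp
  qed
  then show ?thesis by (simp add: sum.distrib)
qed

section \<open>Frames of quasi-commuting clusters\<close>

locale central_unit =
  fixes c :: "'a::division_ring"
  assumes central_c: "central c" and c_nonzero: "c \<noteq> 0"
begin

abbreviation coeffs :: "'a set" where "coeffs \<equiv> subring_gen {c, inverse c}"

lemma central_powi: "y * c powi n = c powi n * y"
proof -
  have "c * y = y * c" for y using central_c by (simp add: central_def)
  moreover from this have "inverse c * y = y * inverse c" for y
  proof -
    have "inverse c * y = inverse c * (y * c) * inverse c"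
      using c_nonzero by (simp add: mult.assoc)
    also have "\<dots> = inverse c * (c * y) * inverse c"
      using \<open>c * y = y * c\<close> by simp
    also have "\<dots> = y * inverse c"
      using c_nonzero by (simp flip: mult.assoc)
    finally show ?thesis .
  qed
  ultimately show ?thesis
    unfolding power_int_def by (auto intro: power_commuting_commutes[symmetric])
qed

lemma central_powi_left: "y * (c powi n * w) = c powi n * (y * w)"
  by (metis central_powi mult.assoc)

lemma c_powi_mult [simp]: "c powi m * c powi n = c powi (m + n)"
  using c_nonzero by (simp add: power_int_add)

lemma c_powi_mult_left [simp]: "c powi m * (c powi n * w) = c powi (m + n) * w"
  by (simp flip: mult.assoc)

lemma coeffs_central: "u \<in> coeffs \<Longrightarrow> y * u = u * y"
proof (induction rule: subring_gen.induct)
  case (gen x)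
  then show ?case
    using central_powi[of y 1] central_powi[of y "-1"] by (auto simp: power_int_minus)
qed (auto simp: algebra_simps, metis mult.assoc)

lemma coeffs_powi: "c powi n \<in> coeffs"
  by (rule subring_gen_power_int) (auto intro: subring_gen.gen)

text \<open>Powers of \<open>b\<close> are treated first, by induction in both directions on the
  integers; the rule so obtained is then applied to the pair \<open>b powi n\<close> and
  \<open>a\<close>.\<close>

lemma quasi_commute_powi:
  assumes ab: "a * b = c powi e * (b * a)" and nz: "a \<noteq> 0" "b \<noteq> 0"
  shows "a powi m * b powi n = c powi (e * m * n) * (b powi n * a powi m)"
proof -
  have right: "a * b powi n = c powi (e * n) * (b powi n * a)"
    if ab: "a * b = c powi e * (b * a)" and nz: "b \<noteq> 0" for a b e n
  proof (induction n rule: int_induct[where k = 0])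
    case base
    show ?case by simp
  next
    case (step1 i)
    have bp: "b powi (i + 1) = b powi i * b"
      using nz by (simp add: power_int_add)
    have "a * b powi (i + 1) = (a * b powi i) * b"
      by (simp add: bp mult.assoc)
    also have "\<dots> = c powi (e * i) * (b powi i * (a * b))"
      by (simp add: step1.IH mult.assoc)
    also have "\<dots> = c powi (e * i) * (b powi i * (c powi e * (b * a)))"
      unfolding ab ..
    also have "\<dots> = c powi (e * (i + 1)) * (b powi (i + 1) * a)"
      by (simp only: bp central_powi_left[of "b powi i"] c_powi_mult_left mult.assoc distrib_left mult_1_right)
    finally show ?case .
  next
    case (step2 i)
    have bp: "b powi (i - 1) = b powi i * inverse b"
      using power_int_add[of b i "-1"] nz by (simp add: power_int_minus)
    \<comment> \<open>Multiplying this by \<open>inverse b\<close> on both sides turns it into the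
      commutation rule of \<open>a\<close> with \<open>inverse b\<close>.\<close>
    have "b * a = c powi (- e) * (a * b)"
      unfolding ab by simp
    then have "inverse b * (b * a) * inverse b = inverse b * (c powi (- e) * (a * b)) * inverse b"
      by simp
    moreover have "inverse b * (b * a) * inverse b = a * inverse b"
      using nz by (simp flip: mult.assoc)
    ultimately have ab': "a * inverse b = c powi (- e) * (inverse b * a)"
      using nz by (simp add: central_powi_left[of "inverse b"] mult.assoc)
    have "a * b powi (i - 1) = (a * b powi i) * inverse b"
      by (simp only: bp mult.assoc)
    also have "\<dots> = c powi (e * i) * (b powi i * (a * inverse b))"
      by (simp add: step2.IH mult.assoc)
    also have "\<dots> = c powi (e * i) * (b powi i * (c powi (- e) * (inverse b * a)))"
      unfolding ab' ..
    also have "\<dots> = c powi (e * (i - 1)) * (b powi (i - 1) * a)"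
      by (simp add: bp central_powi_left[of "b powi i"] mult.assoc right_diff_distrib)
    finally show ?case .
  qed
  have "b powi n * a = c powi (- (e * n)) * (a * b powi n)"
    unfolding right[OF ab nz(2)] by simp
  from right[OF this nz(1), of m]
  have "b powi n * a powi m = c powi (- (e * n * m)) * (a powi m * b powi n)"
    by simp
  then show ?thesis
    by (simp add: algebra_simps)
qed

text \<open>In a frame, both products of the monomials at \<open>f\<close> and \<open>g\<close> are
  multiples of the same monomial, by \<open>c\<close> to the values of the form at
  \<open>(f, g)\<close> and at \<open>(g, f)\<close>. These values have opposite signs, whence the
  factor 2.\<close>

definition quasi_commuting :: "nat \<Rightarrow> (nat \<Rightarrow> nat \<Rightarrow> int) \<Rightarrow> (nat \<Rightarrow> 'a) \<Rightarrow> bool" where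
  "quasi_commuting N lam x \<longleftrightarrow> (\<forall>i\<in>{1..N}. x i \<noteq> 0) \<and>
     (\<forall>i\<in>{1..N}. \<forall>j\<in>{1..N}. x i * x j = c powi (2 * lam i j) * (x j * x i))"

lemma quasi_commutingD:
  "quasi_commuting N lam x \<Longrightarrow> i \<in> {1..N} \<Longrightarrow> j \<in> {1..N} \<Longrightarrow> x i * x j = c powi (2 * lam i j) * (x j * x i)"
  unfolding quasi_commuting_def by blast

lemma quasi_commuting_nonzero: "quasi_commuting N lam x \<Longrightarrow> i \<in> {1..N} \<Longrightarrow> x i \<noteq> 0"
  by (simp add: quasi_commuting_def)

lemma powi_mult_oprod:
  assumes "quasi_commuting N lam x" "j \<in> {1..N}" "n \<le> N"
  shows "x j powi a * oprod n x g
       = c powi (2 * a * (\<Sum>i\<in>{1..n}. lam j i * g i)) * (oprod n x g * x j powi a)"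
  using assms(3)
proof (induction n)
  case (Suc n)
  have "x j powi a * x (Suc n) powi g (Suc n)
      = c powi (2 * lam j (Suc n) * a * g (Suc n)) * (x (Suc n) powi g (Suc n) * x j powi a)"
  proof (rule quasi_commute_powi)
    show "x j * x (Suc n) = c powi (2 * lam j (Suc n)) * (x (Suc n) * x j)" "x j \<noteq> 0" "x (Suc n) \<noteq> 0"
      using assms(2) Suc.prems
      by (auto intro!: quasi_commutingD[OF assms(1)] simp: quasi_commuting_nonzero[OF assms(1)])
  qed
  note qc = this
  have "x j powi a * oprod (Suc n) x g = (x j powi a * oprod n x g) * x (Suc n) powi g (Suc n)"
    by (simp add: oprod_Suc mult.assoc)
  also have "\<dots> = c powi (2 * a * (\<Sum>i\<in>{1..n}. lam j i * g i)) * (oprod n x g * (x j powi a * x (Suc n) powi g (Suc n)))"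
    using Suc by (simp add: mult.assoc)
  also have "\<dots> = c powi (2 * a * (\<Sum>i\<in>{1..Suc n}. lam j i * g i)) * (oprod (Suc n) x g * x j powi a)"
    unfolding qc by (simp add: central_powi_left[of "oprod n x g"] oprod_Suc mult.assoc) (simp add: algebra_simps)
  finally show ?case .
qed simp

lemma frame_val_Suc:
  "frame_val (Suc n) c lam x f = c powi (- (\<Sum>i\<in>{1..n}. lam i (Suc n) * f i) * f (Suc n))
     * (frame_val n c lam x f * x (Suc n) powi f (Suc n))"
proof -
  define A where "A = (\<Sum>i\<in>{1..n}. \<Sum>j\<in>{i<..n}. lam i j * f i * f j)"
  define T where "T = (\<Sum>i\<in>{1..n}. lam i (Suc n) * f i)"
  have "(\<Sum>i\<in>{1..n}. lam i (Suc n) * f i * f (Suc n)) = T * f (Suc n)"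
    by (simp add: T_def sum_distrib_right)
  moreover have "- (A + T * f (Suc n)) = - T * f (Suc n) + - A"
    by simp
  ultimately show ?thesis
    unfolding frame_val_def upper_triangle_sum_Suc oprod_Suc A_def[symmetric] T_def[symmetric]
    by (simp only: mult.assoc[where 'a='a] c_powi_mult_left)
qed

text \<open>In the induction step, moving the last power of the first monomial past the earlier
  variables of the second costs \<open>- 2 * f (Suc n) * s g\<close>. Added to the form in
  \<open>n\<close> variables and the normalising exponents of both factors, this is the form in
  \<open>Suc n\<close> variables plus the normalising exponent of the product.\<close>

lemma frame_val_mult:
  assumes "skew_int N lam" "quasi_commuting N lam x"
  shows "frame_val N c lam x f * frame_val N c lam x g
       = c powi (bform N lam f g) * frame_val N c lam x (\<lambda>i. f i + g i)"
proof -
  have "frame_val n c lam x f * frame_val n c lam x g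
       = c powi (bform n lam f g) * frame_val n c lam x (\<lambda>i. f i + g i)" if "n \<le> N" for n
    using that
  proof (induction n)
    case 0
    show ?case by (simp add: frame_val_def bform_def)
  next
    case (Suc n)
    let ?F = "frame_val n c lam x" and ?y = "x (Suc n)"
    define s where "s h = (\<Sum>i\<in>{1..n}. lam i (Suc n) * h i)" for h
    have s_add: "s (\<lambda>i. f i + g i) = s f + s g"
      by (simp add: s_def algebra_simps sum.distrib)
    have skew: "skew_int (Suc n) lam"
      using assms(1) Suc.prems unfolding skew_int_def by (meson atLeastAtMost_iff order.trans)
    then have "lam (Suc n) i = - lam i (Suc n)" if "i \<in> {1..n}" for i
    proof -
      have "i \<in> {1..Suc n}" "Suc n \<in> {1..Suc n}" using that by auto
      with skew show ?thesis unfolding skew_int_def by blast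
    qed
    then have "(\<Sum>i\<in>{1..n}. lam (Suc n) i * g i) = - s g"
      unfolding s_def sum_negf[symmetric] by (intro sum.cong) auto
    then have "?y powi f (Suc n) * oprod n x g = c powi (- 2 * f (Suc n) * s g) * (oprod n x g * ?y powi f (Suc n))"
      using powi_mult_oprod[OF assms(2), of "Suc n" n "f (Suc n)" g] Suc.prems by simp
    then have qc: "?y powi f (Suc n) * ?F g = c powi (- 2 * f (Suc n) * s g) * (?F g * ?y powi f (Suc n))"
      unfolding frame_val_def
      by (simp only: central_powi_left[of "?y powi f (Suc n)"] mult.assoc[where 'a='a] c_powi_mult_left add.commute)
    have ynz: "?y \<noteq> 0" using assms(2) Suc.prems by (auto simp: quasi_commuting_def)
    have "frame_val (Suc n) c lam x f * frame_val (Suc n) c lam x g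
       = c powi (- s f * f (Suc n) - s g * g (Suc n)) * (?F f * ((?y powi f (Suc n) * ?F g) * ?y powi g (Suc n)))"
      unfolding frame_val_Suc s_def[symmetric]
      by (simp add: central_powi_left[of "?y powi f (Suc n)"] central_powi_left[of "?F f"] mult.assoc)
    also have "\<dots> = c powi (- s f * f (Suc n) - s g * g (Suc n) - 2 * f (Suc n) * s g)
            * ((?F f * ?F g) * ?y powi (f (Suc n) + g (Suc n)))"
      unfolding qc using ynz
      by (simp add: central_powi_left[of "?F f"] mult.assoc power_int_add)
    also have "\<dots> = c powi (bform (Suc n) lam f g) * frame_val (Suc n) c lam x (\<lambda>i. f i + g i)"
      using Suc unfolding frame_val_Suc bform_Suc[OF skew] s_def[symmetric] s_add
      by (simp add: mult.assoc) (simp add: algebra_simps)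
    finally show ?case .
  qed
  then show ?thesis by simp
qed

end

section \<open>Evaluation of integer polynomials and clearing of denominators\<close>

lemma ipoly_eq_sum:
  assumes "degree p \<le> n"
  shows "ipoly p c = (\<Sum>i\<le>n. of_int (coeff p i) * c ^ i)"
  unfolding ipoly_def using assms
  by (intro sum.mono_neutral_left) (auto simp: coeff_eq_0)

lemma ipoly_0 [simp]: "ipoly 0 c = 0"
  by (simp add: ipoly_def)

lemma ipoly_add: "ipoly (p + q) c = ipoly p c + ipoly q c"
proof -
  let ?n = "max (degree p) (degree q)"
  have "degree (p + q) \<le> ?n" by (rule degree_add_le) auto
  then show ?thesis
    by (simp add: ipoly_eq_sum[of _ ?n] distrib_right sum.distrib)
qed

lemma ipoly_smult: "ipoly (smult a p) c = of_int a * ipoly p c"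
  by (simp add: ipoly_eq_sum[OF degree_smult_le] ipoly_def[of p] sum_distrib_left mult.assoc)

lemma ipoly_pCons: "ipoly (pCons a p) c = of_int a + c * ipoly p c"
proof -
  have "ipoly (pCons a p) c = (\<Sum>i\<le>Suc (degree p). of_int (coeff (pCons a p) i) * c ^ i)"
    by (rule ipoly_eq_sum) (rule degree_pCons_le)
  also have "\<dots> = of_int a + (\<Sum>i\<le>degree p. c * (of_int (coeff p i) * c ^ i))"
  proof -
    have "of_int a * c ^ Suc i = c * (of_int a * c ^ i)" for a i
      by (simp add: mult_of_int_commute mult.assoc flip: mult.assoc[of c "of_int a"])
    then show ?thesis
      unfolding sum.atMost_Suc_shift coeff_pCons_0 coeff_pCons_Suc by simp
  qed
  finally show ?thesis
    by (simp add: ipoly_def sum_distrib_left)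
qed

lemma ipoly_mult: "ipoly (p * q) c = ipoly p c * ipoly q c"
proof (induction p)
  case (pCons a p)
  then show ?case
    by (simp add: mult_pCons_left ipoly_add ipoly_smult ipoly_pCons algebra_simps)
qed simp

context central_unit
begin

text \<open>Stated for all large \<open>n\<close> since several coefficients have to be cleared by
  one common power of \<open>c\<close>. In the product case \<open>x\<close> takes \<open>m\<close>
  factors and \<open>y\<close> the remaining \<open>n - m\<close>.\<close>

lemma coeffs_clear_denominators:
  assumes "u \<in> coeffs"
  shows "\<exists>m. \<forall>n\<ge>m. \<exists>p. u * c ^ n = ipoly p c"
  using assms
proof induction
  case (gen x)
  have monom: "\<exists>p. c ^ n = ipoly p c" for n
    by (rule exI[of _ "monom 1 n"]) (simp add: ipoly_eq_sum[OF degree_monom_le] if_distrib[of "\<lambda>a. of_int a * _"] cong: if_cong)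
  have "x * c ^ Suc n = c ^ Suc (Suc n) \<or> x * c ^ Suc n = c ^ n" for n
    using gen c_nonzero by (auto simp flip: mult.assoc)
  then have "\<forall>n\<ge>1. \<exists>p. x * c ^ n = ipoly p c"
    using monom by (metis Suc_le_D One_nat_def)
  then show ?case by blast
next
  case one
  have "\<exists>p. 1 * c ^ n = ipoly p c" for n
    by (rule exI[of _ "monom 1 n"]) (simp add: ipoly_eq_sum[OF degree_monom_le] if_distrib[of "\<lambda>a. of_int a * _"] cong: if_cong)
  then show ?case by blast
next
  case (add x y)
  then obtain m m' where m: "\<forall>n\<ge>m. \<exists>p. x * c ^ n = ipoly p c" "\<forall>n\<ge>m'. \<exists>p. y * c ^ n = ipoly p c"
    by blast
  have "\<exists>p. (x + y) * c ^ n = ipoly p c" if "n \<ge> max m m'" for n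
  proof -
    obtain p q where "x * c ^ n = ipoly p c" "y * c ^ n = ipoly q c"
      using m \<open>n \<ge> max m m'\<close> by fastforce
    then have "(x + y) * c ^ n = ipoly (p + q) c"
      by (simp add: ipoly_add distrib_right)
    then show ?thesis ..
  qed
  then show ?case by blast
next
  case (neg x)
  then obtain m where m: "\<forall>n\<ge>m. \<exists>p. x * c ^ n = ipoly p c" by blast
  have "\<exists>p. - x * c ^ n = ipoly p c" if "n \<ge> m" for n
  proof -
    obtain p where "x * c ^ n = ipoly p c" using m \<open>n \<ge> m\<close> by blast
    then have "- x * c ^ n = ipoly (- p) c" using ipoly_smult[of "-1" p c] by simp
    then show ?thesis ..
  qed
  then show ?case by blast
next
  case (mult x y)
  then obtain m m' where m: "\<forall>n\<ge>m. \<exists>p. x * c ^ n = ipoly p c" "\<forall>n\<ge>m'. \<exists>p. y * c ^ n = ipoly p c"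
    by blast
  have "\<exists>p. x * y * c ^ n = ipoly p c" if "n \<ge> m + m'" for n
  proof -
    have "m \<le> m" "m' \<le> n - m" using that by auto
    then obtain p q where "x * c ^ m = ipoly p c" "y * c ^ (n - m) = ipoly q c"
      using m by blast
    moreover have "x * c ^ m * (y * c ^ (n - m)) = x * y * c ^ n"
    proof -
      have "x * c ^ m * (y * c ^ (n - m)) = x * (y * c ^ m) * c ^ (n - m)"
        using central_powi_left[of y "int m"] by (simp add: mult.assoc)
      also have "\<dots> = x * y * (c ^ m * c ^ (n - m))"
        by (simp only: mult.assoc)
      finally show ?thesis using that by (simp flip: power_add)
    qed
    ultimately have "x * y * c ^ n = ipoly (p * q) c" by (simp add: ipoly_mult)
    then show ?thesis ..
  qed
  then show ?case by blast
qed

section \<open>Frames and linear independence of their monomials\<close>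

definition frame :: "nat \<Rightarrow> (nat \<Rightarrow> nat \<Rightarrow> int) \<Rightarrow> ((nat \<Rightarrow> int) \<Rightarrow> 'a) \<Rightarrow> bool" where
  "frame N lam M \<longleftrightarrow> M (\<lambda>i. 0) = 1 \<and>
     (\<forall>f\<in>zvec N. \<forall>g\<in>zvec N. M f * M g = c powi bform N lam f g * M (\<lambda>i. f i + g i))"

lemma frame_zero: "frame N lam M \<Longrightarrow> M (\<lambda>i. 0) = 1"
  by (simp add: frame_def)

lemma frame_mult:
  "frame N lam M \<Longrightarrow> f \<in> zvec N \<Longrightarrow> g \<in> zvec N \<Longrightarrow> M f * M g = c powi bform N lam f g * M (\<lambda>i. f i + g i)"
  unfolding frame_def by blast

lemma frame_nonzero:
  assumes "frame N lam M" "f \<in> zvec N"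
  shows "M f \<noteq> 0"
  using frame_mult[OF assms zvec_uminus[OF assms(2)]] frame_zero[OF assms(1)] c_nonzero by auto

lemma frame_commute:
  assumes "skew_int N lam" "frame N lam M" "f \<in> zvec N" "g \<in> zvec N"
  shows "M f * M g = c powi (2 * bform N lam f g) * (M g * M f)"
  unfolding frame_mult[OF assms(2-4)] frame_mult[OF assms(2,4,3)] bform_skew[OF assms(1), of g f]
  by (simp add: add.commute)

text \<open>The form vanishes between multiples of one vector, so no power of \<open>c\<close>
  appears. Negative exponents follow by cancelling \<open>M v\<close>.\<close>

lemma frame_powi:
  assumes "skew_int N lam" "frame N lam M" "v \<in> zvec N"
  shows "M v powi n = M (\<lambda>i. n * v i)"
proof -
  have zv: "(\<lambda>i. m * v i) \<in> zvec N" for m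
    using assms(3) by (simp add: zvec_def)
  have add: "M (\<lambda>i. m * v i) * M v = M (\<lambda>i. (m + 1) * v i)" for m
    using frame_mult[OF assms(2) zv assms(3), of m] assms(1) by (simp add: bform_scale_left algebra_simps)
  show ?thesis
  proof (induction n rule: int_induct[where k = 0])
    case base
    show ?case using assms(2) by (simp add: frame_zero)
  next
    case (step1 i)
    then show ?case
      using add[of i] frame_nonzero[OF assms(2,3)] by (simp add: power_int_add)
  next
    case (step2 i)
    have "M v powi (i - 1) * M v = M v powi i"
      using frame_nonzero[OF assms(2,3)] power_int_add[of "M v" "i - 1" 1] by simp
    also have "\<dots> = M (\<lambda>j. (i - 1) * v j) * M v"
      using step2 add[of "i - 1"] by simp
    finally show ?case
      using frame_nonzero[OF assms(2,3)] by simp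
  qed
qed

lemma frame_frame_val:
  assumes "skew_int N lam" "quasi_commuting N lam x"
  shows "frame N lam (frame_val N c lam x)"
proof -
  have "oprod n x (\<lambda>i. 0) = 1" for n
    by (induction n) (auto simp: oprod_Suc)
  then show ?thesis
    unfolding frame_def frame_val_mult[OF assms] by (simp add: frame_val_def)
qed

lemma frame_val_unitv:
  assumes "k \<in> {1..N}"
  shows "frame_val N c lam x (unitv k) = x k"
proof -
  have "oprod n x (unitv k) = (if k \<le> n then x k else 1)" for n
    using assms by (induction n) (auto simp: oprod_Suc unitv_def le_Suc_eq)
  moreover have "(\<Sum>i\<in>{1..N}. \<Sum>j\<in>{i<..N}. lam i j * unitv k i * unitv k j) = 0"
    by (intro sum.neutral ballI) (auto simp: unitv_def)
  ultimately show ?thesis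
    using assms by (simp add: frame_val_def)
qed

text \<open>Only indices in the support of \<open>f\<close> matter. For exponents vanishing at
  \<open>k\<close> this identifies the monomials of a seed with those of its mutation at
  \<open>k\<close>.\<close>

lemma frame_val_cong:
  assumes "\<And>i. i \<in> {1..N} \<Longrightarrow> f i = g i"
    and "\<And>i. i \<in> {1..N} \<Longrightarrow> f i \<noteq> 0 \<Longrightarrow> x i = y i"
    and "\<And>i j. i \<in> {1..N} \<Longrightarrow> j \<in> {1..N} \<Longrightarrow> f i \<noteq> 0 \<Longrightarrow> f j \<noteq> 0 \<Longrightarrow> lam i j = lam' i j"
  shows "frame_val N c lam x f = frame_val N c lam' y g"
proof -
  have "x i powi f i = y i powi g i" if "i \<in> {1..N}" for i
    using assms(1,2)[OF that] by (cases "f i = 0") auto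
  then have "oprod N x f = oprod N y g"
    by (rule oprod_cong)
  moreover have "lam i j * f i * f j = lam' i j * g i * g j" if "i \<in> {1..N}" "j \<in> {1..N}" for i j
    using assms(1)[OF that(1)] assms(1)[OF that(2)] assms(3)[OF that] by (cases "f i = 0 \<or> f j = 0") auto
  then have "(\<Sum>i\<in>{1..N}. \<Sum>j\<in>{i<..N}. lam i j * f i * f j) = (\<Sum>i\<in>{1..N}. \<Sum>j\<in>{i<..N}. lam' i j * g i * g j)"
    by (intro sum.cong refl) auto
  ultimately show ?thesis
    by (simp add: frame_val_def)
qed

text \<open>A seed stores only the variables \<open>M (unitv i)\<close>; the whole frame is
  recovered from them.\<close>

lemma frame_eq_frame_val:
  assumes "skew_int N lam" "frame N lam M" "f \<in> zvec N"
  shows "frame_val N c lam (\<lambda>i. M (unitv i)) f = M f"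
proof -
  \<comment> \<open>Truncation after coordinate \<open>n\<close>: the induction builds
    \<open>f\<close> up one coordinate at a time, and \<open>tr N\<close> is \<open>f\<close>
    again.\<close>
  define tr where "tr n = (\<lambda>i. if i \<le> n then f i else 0)" for n
  have tr: "tr n \<in> zvec N" for n
    using assms(3) by (auto simp: tr_def zvec_def)
  have "frame_val n c lam (\<lambda>i. M (unitv i)) f = M (tr n)" if "n \<le> N" for n
    using that
  proof (induction n)
    case 0
    have "tr 0 = (\<lambda>i. 0)" using assms(3) by (auto simp: tr_def zvec_def)
    then show ?case using assms(2) by (simp add: frame_val_def frame_zero)
  next
    case (Suc n)
    define v where "v = (\<lambda>i. f (Suc n) * unitv (Suc n) i)"
    have v: "v \<in> zvec N" "unitv (Suc n) \<in> zvec N"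
      using Suc.prems by (auto simp: v_def zvec_def unitv_def)
    have "bform N lam (tr n) v = (\<Sum>i\<in>{1..N}. tr n i * lam i (Suc n)) * f (Suc n)"
      using Suc.prems bform_unitv_right[of "Suc n" N lam "tr n"]
      unfolding v_def bform_scale_right by simp
    also have "(\<Sum>i\<in>{1..N}. tr n i * lam i (Suc n)) = (\<Sum>i\<in>{1..n}. lam i (Suc n) * f i)"
      using Suc.prems by (intro sum.mono_neutral_cong_right) (auto simp: tr_def)
    finally have "bform N lam (tr n) v = (\<Sum>i\<in>{1..n}. lam i (Suc n) * f i) * f (Suc n)" .
    moreover have "(\<lambda>i. tr n i + v i) = tr (Suc n)"
      by (rule ext) (auto simp: tr_def v_def unitv_def le_Suc_eq)
    moreover have "M (unitv (Suc n)) powi f (Suc n) = M v"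
      using frame_powi[OF assms(1,2) v(2), of "f (Suc n)"] by (simp add: v_def)
    ultimately show ?case
      using Suc by (simp add: frame_val_Suc frame_mult[OF assms(2) tr v(1)])
  qed
  moreover have "tr N = f" using assms(3) by (auto simp: tr_def zvec_def)
  ultimately show ?thesis by auto
qed

text \<open>Coefficients are elements of the division ring and not polynomials, so the same
  condition serves for a transcendental \<open>c\<close> and for a root of unity.\<close>

definition independent :: "nat \<Rightarrow> ((nat \<Rightarrow> int) \<Rightarrow> 'a) \<Rightarrow> bool" where
  "independent N M \<longleftrightarrow> (\<forall>S u. finite S \<longrightarrow> S \<subseteq> zvec N \<longrightarrow> (\<forall>f\<in>S. u f \<in> coeffs) \<longrightarrow>
     (\<Sum>f\<in>S. u f * M f) = 0 \<longrightarrow> (\<forall>f\<in>S. u f = 0))"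

lemma independentD:
  "independent N M \<Longrightarrow> finite S \<Longrightarrow> S \<subseteq> zvec N \<Longrightarrow> (\<And>f. f \<in> S \<Longrightarrow> u f \<in> coeffs) \<Longrightarrow>
     (\<Sum>f\<in>S. u f * M f) = 0 \<Longrightarrow> f \<in> S \<Longrightarrow> u f = 0"
  unfolding independent_def by blast

text \<open>Toric frames speak of polynomials in \<open>c\<close>, while coefficients here also
  involve \<open>inverse c\<close>. Multiplying the relation by a common power of the central
  \<open>c\<close> passes from the latter to the former.\<close>

lemma toric_frame_independent:
  assumes "eps_toric_frame N c lam M"
  shows "independent N M"
  unfolding independent_def
proof (intro allI impI ballI)
  fix S u f
  assume S: "finite S" "S \<subseteq> zvec N" "\<forall>f\<in>S. u f \<in> coeffs" "(\<Sum>f\<in>S. u f * M f) = 0" "f \<in> S"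
  have "\<forall>f\<in>S. \<exists>m. \<forall>n\<ge>m. \<exists>p. u f * c ^ n = ipoly p c"
    using S(3) coeffs_clear_denominators by blast
  then obtain m where m: "\<forall>f\<in>S. \<forall>n\<ge>m f. \<exists>p. u f * c ^ n = ipoly p c"
    by metis
  define n where "n = Max (m ` S)"
  have "m f \<le> n" if "f \<in> S" for f
    using S(1) that by (simp add: n_def)
  then have "\<forall>f. \<exists>p. f \<in> S \<longrightarrow> u f * c ^ n = ipoly p c"
    using m by blast
  then obtain p where p: "\<And>f. f \<in> S \<Longrightarrow> u f * c ^ n = ipoly (p f) c"
    unfolding choice_iff by blast
  have "(\<Sum>f\<in>S. ipoly (p f) c * M f) = c ^ n * (\<Sum>f\<in>S. u f * M f)"
    unfolding sum_distrib_left
  proof (intro sum.cong refl)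
    fix f assume "f \<in> S"
    have "ipoly (p f) c = c ^ n * u f"
      using p[OF \<open>f \<in> S\<close>] central_powi[of "u f" "int n"] by simp
    then show "ipoly (p f) c * M f = c ^ n * (u f * M f)"
      by (simp add: mult.assoc)
  qed
  then have "ipoly (p f) c = 0"
    using assms[unfolded eps_toric_frame_def, THEN conjunct2, THEN conjunct1, rule_format, of S p f] S by simp
  then show "u f = 0"
    using p[OF S(5)] c_nonzero by simp
qed

text \<open>The multiplication rule alone also admits the zero map. Independence makes
  \<open>M (\<lambda>i. 0)\<close> nonzero and the rule makes it idempotent, so in a division ring
  it is 1.\<close>

lemma toric_frame_frame:
  assumes "eps_toric_frame N c lam M"
  shows "frame N lam M"
proof -
  have "M (\<lambda>i. 0) \<noteq> 0"
    using independentD[OF toric_frame_independent[OF assms], of "{\<lambda>i. 0}" "\<lambda>_. 1"]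
    by (auto intro: subring_gen.one)
  moreover have mult: "\<forall>f\<in>zvec N. \<forall>g\<in>zvec N. M f * M g = c powi bform N lam f g * M (\<lambda>i. f i + g i)"
    by (rule assms[unfolded eps_toric_frame_def, THEN conjunct1])
  from mult[rule_format, OF zvec_zero zvec_zero] have "M (\<lambda>i. 0) * M (\<lambda>i. 0) = M (\<lambda>i. 0)"
    by simp
  ultimately have "M (\<lambda>i. 0) = 1"
    using mult_left_cancel[of "M (\<lambda>i. 0)" "M (\<lambda>i. 0)" 1] by simp
  then show ?thesis
    using mult unfolding frame_def by blast
qed

section \<open>Spans of monomials and their grading\<close>

inductive_set mono_span :: "((nat \<Rightarrow> int) \<Rightarrow> 'a) \<Rightarrow> (nat \<Rightarrow> int) set \<Rightarrow> 'a set"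
  for M :: "(nat \<Rightarrow> int) \<Rightarrow> 'a" and F :: "(nat \<Rightarrow> int) set" where
  zero: "0 \<in> mono_span M F"
| step: "u \<in> coeffs \<Longrightarrow> f \<in> F \<Longrightarrow> h \<in> mono_span M F \<Longrightarrow> u * M f + h \<in> mono_span M F"

lemma mono_span_term: "u \<in> coeffs \<Longrightarrow> f \<in> F \<Longrightarrow> u * M f \<in> mono_span M F"
  using mono_span.step[OF _ _ mono_span.zero] by simp

lemma mono_span_add: "h \<in> mono_span M F \<Longrightarrow> h' \<in> mono_span M F \<Longrightarrow> h + h' \<in> mono_span M F"
  by (induction rule: mono_span.induct) (auto simp: add.assoc intro: mono_span.step)

lemma mono_span_sum: "(\<And>i. i \<in> I \<Longrightarrow> h i \<in> mono_span M F) \<Longrightarrow> sum h I \<in> mono_span M F"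
  by (induction I rule: infinite_finite_induct) (auto intro: mono_span_add mono_span.zero)

lemma mono_span_uminus: "h \<in> mono_span M F \<Longrightarrow> - h \<in> mono_span M F"
proof (induction rule: mono_span.induct)
  case (step u f h)
  then show ?case
    using mono_span_add[OF mono_span_term[OF subring_gen.neg[OF step(1)] step(2)] step(4)] by simp
qed (simp add: mono_span.zero)

text \<open>The index sets enter only through addition, so one fact covers both graded pieces, whose
  degrees add, and the exponents of a mixed torus, which are closed under sums.\<close>

lemma mono_span_mult:
  assumes "frame N lam M" "F \<subseteq> zvec N" "G \<subseteq> zvec N"
    and "\<And>f g. f \<in> F \<Longrightarrow> g \<in> G \<Longrightarrow> (\<lambda>i. f i + g i) \<in> H"
    and "a \<in> mono_span M F" "b \<in> mono_span M G"
  shows "a * b \<in> mono_span M H"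
  using assms(5)
proof induction
  case (step u f a)
  have "u * M f * b \<in> mono_span M H"
    using assms(6)
  proof induction
    case (step v g b)
    have "u * M f * (v * M g) = u * (M f * v) * M g"
      by (simp add: mult.assoc)
    also have "\<dots> = u * v * (M f * M g)"
      unfolding coeffs_central[OF step(1), of "M f"] by (simp add: mult.assoc)
    also have "\<dots> = u * v * c powi bform N lam f g * M (\<lambda>i. f i + g i)"
      using frame_mult[OF assms(1)] \<open>f \<in> F\<close> step(2) assms(2,3) by (simp add: mult.assoc subset_iff)
    also have "\<dots> \<in> mono_span M H"
      using step \<open>f \<in> F\<close> \<open>u \<in> coeffs\<close> assms(4)
      by (intro mono_span_term subring_gen.mult coeffs_powi) auto
    finally show ?case
      using step(4) by (simp add: distrib_left mono_span_add)
  qed (simp add: mono_span.zero)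
  then show ?case
    using step.IH by (simp add: distrib_right mono_span_add)
qed (simp add: mono_span.zero)

text \<open>Elements of the span are built term by term, possibly with repeated exponents, which are
  collected here. Keeping \<open>u\<close> zero off \<open>S\<close> lets a new and an old exponent
  be handled by the same update of \<open>u\<close>.\<close>

lemma mono_span_expand:
  assumes "h \<in> mono_span M F"
  obtains S u where "finite S" "S \<subseteq> F" "\<And>f. u f \<in> coeffs" "\<And>f. f \<notin> S \<Longrightarrow> u f = 0"
    "h = (\<Sum>f\<in>S. u f * M f)"
proof -
  have "\<exists>S u. finite S \<and> S \<subseteq> F \<and> (\<forall>f. u f \<in> coeffs) \<and> (\<forall>f. f \<notin> S \<longrightarrow> u f = 0) \<and> h = (\<Sum>f\<in>S. u f * M f)"
    using assms
  proof induction
    case zero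
    show ?case
      by (rule exI[of _ "{}"], rule exI[of _ "\<lambda>_. 0"]) (simp add: subring_gen_zero)
  next
    case (step v g h)
    then obtain S u where S: "finite S" "S \<subseteq> F" "\<forall>f. u f \<in> coeffs" "\<forall>f. f \<notin> S \<longrightarrow> u f = 0" "h = (\<Sum>f\<in>S. u f * M f)"
      by blast
    have "h = (\<Sum>f\<in>insert g S. u f * M f)"
      using S by (cases "g \<in> S") (auto simp: insert_absorb)
    also have "\<dots> = u g * M g + (\<Sum>f\<in>S - {g}. u f * M f)"
      using S(1) by (rule sum.insert_remove)
    finally have "v * M g + h = (v + u g) * M g + (\<Sum>f\<in>S - {g}. (u(g := v + u g)) f * M f)"
      by (simp add: distrib_right add.assoc)
    also have "\<dots> = (\<Sum>f\<in>insert g S. (u(g := v + u g)) f * M f)"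
      using S(1) by (subst sum.insert_remove) auto
    finally show ?case
      using S step(1,2) by (intro exI[of _ "insert g S"] exI[of _ "u(g := v + u g)"]) (auto intro: subring_gen.add)
  qed
  then show thesis using that by blast
qed

text \<open>Pieces of different degree in coordinate \<open>k\<close> have disjoint supports, so
  their sum is one relation between distinct monomials.\<close>

lemma graded_sum_eq_0:
  assumes "independent N M" "finite I" "\<And>n. n \<in> I \<Longrightarrow> h n \<in> mono_span M {f \<in> zvec N. f k = n}"
    and "sum h I = 0" "n \<in> I"
  shows "h n = 0"
proof -
  have "\<forall>n. \<exists>S u. n \<in> I \<longrightarrow> finite S \<and> S \<subseteq> {f \<in> zvec N. f k = n} \<and> (\<forall>f. u f \<in> coeffs) \<and> h n = (\<Sum>f\<in>S. u f * M f)"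
  proof
    fix n
    show "\<exists>S u. n \<in> I \<longrightarrow> finite S \<and> S \<subseteq> {f \<in> zvec N. f k = n} \<and> (\<forall>f. u f \<in> coeffs) \<and> h n = (\<Sum>f\<in>S. u f * M f)"
    proof (cases "n \<in> I")
      case True
      from assms(3)[OF this] obtain S u where "finite S" "S \<subseteq> {f \<in> zvec N. f k = n}" "\<And>f. u f \<in> coeffs"
        "\<And>f. f \<notin> S \<Longrightarrow> u f = 0" "h n = (\<Sum>f\<in>S. u f * M f)"
        by (rule mono_span_expand) blast
      then show ?thesis by (intro exI[of _ S] exI[of _ u]) simp
    qed simp
  qed
  from choice[OF this] obtain S where "\<forall>n. \<exists>u. n \<in> I \<longrightarrow> finite (S n) \<and> S n \<subseteq> {f \<in> zvec N. f k = n} \<and> (\<forall>f. u f \<in> coeffs) \<and> h n = (\<Sum>f\<in>S n. u f * M f)"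
    by (rule exE)
  from choice[OF this] obtain u where Su: "\<forall>n. n \<in> I \<longrightarrow> finite (S n) \<and> S n \<subseteq> {f \<in> zvec N. f k = n} \<and> (\<forall>f. u n f \<in> coeffs) \<and> h n = (\<Sum>f\<in>S n. u n f * M f)"
    by (rule exE)
  have S: "finite (S n)" "S n \<subseteq> {f \<in> zvec N. f k = n}" "u n f \<in> coeffs" "h n = (\<Sum>f\<in>S n. u n f * M f)"
    if "n \<in> I" for n f
    using Su[rule_format, OF that] by simp_all
  \<comment> \<open>Since \<open>f k\<close> tells to which piece an exponent belongs,
    \<open>u (f k) f\<close> is a single coefficient function on the union.\<close>
  have "(\<Sum>f\<in>(\<Union>n\<in>I. S n). u (f k) f * M f) = (\<Sum>n\<in>I. \<Sum>f\<in>S n. u (f k) f * M f)"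
  proof (rule sum.UNION_disjoint)
    show "\<forall>i\<in>I. \<forall>j\<in>I. i \<noteq> j \<longrightarrow> S i \<inter> S j = {}"
    proof (intro ballI impI)
      fix i j assume "i \<in> I" "j \<in> I" "i \<noteq> j"
      then show "S i \<inter> S j = {}" using S(2)[of i] S(2)[of j] by auto
    qed
  qed (use assms(2) S(1) in auto)
  also have "\<dots> = sum h I"
  proof (rule sum.cong[OF refl])
    fix n assume "n \<in> I"
    then show "(\<Sum>f\<in>S n. u (f k) f * M f) = h n"
      using S(2)[of n] unfolding S(4)[OF \<open>n \<in> I\<close>] by (intro sum.cong) auto
  qed
  finally have "(\<Sum>f\<in>(\<Union>n\<in>I. S n). u (f k) f * M f) = 0"
    using assms(4) by simp
  moreover have "finite (\<Union>n\<in>I. S n)" "(\<Union>n\<in>I. S n) \<subseteq> zvec N"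
    using assms(2) S(1,2) by auto
  moreover have "u (f k) f \<in> coeffs" if "f \<in> (\<Union>n\<in>I. S n)" for f
    using S(2,3) that by blast
  ultimately have "u (f k) f = 0" if "f \<in> S n" for f
    using independentD[OF assms(1), of "\<Union>n\<in>I. S n" "\<lambda>f. u (f k) f" f] assms(5) that by blast
  then show ?thesis
    unfolding S(4)[OF assms(5)] using S(2)[OF assms(5)] by (intro sum.neutral) force
qed

end

section \<open>Mutation of seeds\<close>

lemma bform_cong:
  assumes "\<And>i. i \<in> {1..N} \<Longrightarrow> f i = f' i" "\<And>i. i \<in> {1..N} \<Longrightarrow> g i = g' i"
  shows "bform N lam f g = bform N lam f' g'"
  unfolding bform_def using assms by (intro sum.cong refl) auto

lemma bform_sum_left:
  "bform N lam (\<lambda>i. \<Sum>a\<in>A. w a * h a i) g = (\<Sum>a\<in>A. w a * bform N lam (h a) g)"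
  by (induction A rule: infinite_finite_induct) (auto simp: bform_add_left bform_scale_left)

lemma compatible_bform:
  assumes "compatible N ex B lam d" "ex \<subseteq> {1..N}" "j \<in> ex"
  shows "bform N lam (\<lambda>i. B i j) g = d j * g j"
proof -
  have "bform N lam (\<lambda>i. B i j) g = (\<Sum>k\<in>{1..N}. \<Sum>i\<in>{1..N}. B i j * lam i k * g k)"
    unfolding bform_def by (rule sum.swap)
  also have "\<dots> = (\<Sum>k\<in>{1..N}. (if k = j then d j else 0) * g k)"
    using assms(1,3) unfolding compatible_def sum_distrib_right[symmetric] by (intro sum.cong refl) simp
  also have "\<dots> = d j * g j"
    using assms(2,3) by (simp add: if_distrib[of "\<lambda>x. x * _"] subset_iff cong: if_cong)
  finally show ?thesis .
qed

lemma compatible_diag: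
  assumes "compatible N ex B lam d" "k \<in> ex"
  shows "B k k = 0"
proof -
  have "d k * B k k = - (d k * B k k)" "d k > 0" using assms unfolding compatible_def by blast+
  then show ?thesis by simp
qed

lemma mutE_other: "i \<noteq> k \<Longrightarrow> (\<lambda>a. mutE k B a i) = unitv i"
  by (auto simp: mutE_def unitv_def)

lemma mutLam_eq_bform: "mutLam N k B lam i j = bform N lam (\<lambda>a. mutE k B a i) (\<lambda>b. mutE k B b j)"
  by (simp only: mutLam_def bform_def)

lemma skew_int_mutLam: "skew_int N lam \<Longrightarrow> skew_int N (mutLam N k B lam)"
  unfolding skew_int_def[of N "mutLam N k B lam"] mutLam_eq_bform by (intro ballI bform_skew)

lemma mutLam_other:
  "i \<noteq> k \<Longrightarrow> j \<noteq> k \<Longrightarrow> i \<in> {1..N} \<Longrightarrow> j \<in> {1..N} \<Longrightarrow> mutLam N k B lam i j = lam i j"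
  by (simp add: mutLam_eq_bform mutE_other bform_unitv_unitv)

text \<open>Row \<open>i\<close> of the matrix is nonzero at most in columns \<open>i\<close> and
  \<open>k\<close>; row \<open>k\<close> has only the entry -1.\<close>

lemma sum_mutE:
  assumes "i \<in> {1..N}" "k \<in> {1..N}"
  shows "(\<Sum>a\<in>{1..N}. w a * mutE k B i a) = (if i = k then - w k else w i + w k * max 0 (- B i k))"
proof -
  have "(\<Sum>a\<in>{1..N}. w a * mutE k B i a) = w k * mutE k B i k + (\<Sum>a\<in>{1..N} - {k}. w a * mutE k B i a)"
    using assms by (intro sum.remove) auto
  also have "(\<Sum>a\<in>{1..N} - {k}. w a * mutE k B i a) = (\<Sum>a\<in>{1..N} - {k}. if a = i then w i else 0)"
    by (intro sum.cong) (auto simp: mutE_def)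
  also have "\<dots> = (if i = k then 0 else w i)"
    using assms by simp
  finally show ?thesis
    by (simp add: mutE_def)
qed

text \<open>The mixed terms with absolute values equal twice a difference of products of positive
  and negative parts, which removes the integer division by 2.\<close>

lemma mutB_other:
  assumes "i \<noteq> k" "j \<noteq> k"
  shows "mutB k B i j = B i j + max 0 (B i k) * max 0 (B k j) - max 0 (- B i k) * max 0 (- B k j)"
proof -
  have "\<bar>b\<bar> * b' + b * \<bar>b'\<bar> = 2 * (max 0 b * max 0 b' - max 0 (- b) * max 0 (- b'))" for b b' :: int
    by (cases "b \<ge> 0"; cases "b' \<ge> 0") (simp_all add: max_def)
  then show ?thesis
    using assms by (simp add: mutB_def)
qed

text \<open>Both claims rest on \<open>d i * B i k = - (d k * B k i)\<close>, carried over to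
  positive parts since \<open>d\<close> is positive. For the form, \<open>mutE k B\<close> times the
  new column \<open>j\<close> has entries \<open>B b j + max 0 (B k j) * B b k\<close> if
  \<open>j \<noteq> k\<close> and \<open>- B b k\<close> if \<open>j = k\<close>. These are
  combinations of old columns, to which \<open>compatible_bform\<close> applies.\<close>

lemma compatible_mutation:
  assumes compat: "compatible N ex B lam d" and ex: "ex \<subseteq> {1..N}" and k: "k \<in> ex"
  shows "compatible N ex (mutB k B) (mutLam N k B lam) d"
  unfolding compatible_def
proof (intro conjI ballI)
  fix j assume "j \<in> ex"
  then show "d j > 0" using compat by (simp add: compatible_def)
next
  have skew: "d i * B i j = d j * (- B j i)" "d i * (- B i j) = d j * B j i" if "i \<in> ex" "j \<in> ex" for i j
  proof -
    have "d i * B i j = - (d j * B j i)" using compat that unfolding compatible_def by blast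
    then show "d i * B i j = d j * (- B j i)" "d i * (- B i j) = d j * B j i" by simp_all
  qed
  have pos: "d i > 0" if "i \<in> ex" for i
    using compat that by (simp add: compatible_def)
  have scale: "d i * max 0 b = d j * max 0 b'" if "d i * b = d j * b'" "i \<in> ex" "j \<in> ex" for i j b b'
    using that pos[of i] pos[of j] by (simp add: max_mult_distrib_left)
  {
    fix i j assume ij: "i \<in> ex" "j \<in> ex"
    show "d i * mutB k B i j = - (d j * mutB k B j i)"
    proof (cases "i = k \<or> j = k")
      case True
      then show ?thesis using skew[OF ij] by (auto simp: mutB_def)
    next
      case False
      have "d i * (max 0 (B i k) * max 0 (B k j)) = d k * max 0 (- B k i) * max 0 (B k j)"
        using scale[OF skew(1)[OF ij(1) k] ij(1) k] by simp
      also have "\<dots> = d j * (max 0 (- B j k) * max 0 (- B k i))"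
        using scale[OF skew(1)[OF k ij(2)] k ij(2)] by (simp add: algebra_simps)
      finally have 1: "d i * (max 0 (B i k) * max 0 (B k j)) = d j * (max 0 (- B j k) * max 0 (- B k i))" .
      have "d i * (max 0 (- B i k) * max 0 (- B k j)) = d k * max 0 (B k i) * max 0 (- B k j)"
        using scale[OF skew(2)[OF ij(1) k] ij(1) k] by simp
      also have "\<dots> = d j * (max 0 (B j k) * max 0 (B k i))"
        using scale[OF skew(2)[OF k ij(2)] k ij(2)] by (simp add: algebra_simps)
      finally have 2: "d i * (max 0 (- B i k) * max 0 (- B k j)) = d j * (max 0 (B j k) * max 0 (B k i))" .
      show ?thesis
        using False skew(1)[OF ij] 1 2
        by (simp add: mutB_other distrib_left right_diff_distrib)
    qed
  }
  {
    fix j i assume j: "j \<in> ex" and i: "i \<in> {1..N}"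
    have kN: "k \<in> {1..N}" using ex k by blast
    let ?E = "\<lambda>a. mutE k B a i"
    have diag: "B k k = 0" using compatible_diag[OF compat k] .
    have "(\<Sum>a\<in>{1..N}. mutB k B a j * mutLam N k B lam a i)
        = bform N lam (\<lambda>b. \<Sum>a\<in>{1..N}. mutB k B a j * mutE k B b a) ?E"
      unfolding mutLam_eq_bform bform_sum_left ..
    also have "\<dots> = (if i = j then d j else 0)"
    proof (cases "j = k")
      case True
      have "bform N lam (\<lambda>b. \<Sum>a\<in>{1..N}. mutB k B a j * mutE k B b a) ?E = bform N lam (\<lambda>b. - B b k) ?E"
      proof (intro bform_cong refl)
        fix b assume b: "b \<in> {1..N}"
        show "(\<Sum>a\<in>{1..N}. mutB k B a j * mutE k B b a) = - B b k"
          unfolding sum_mutE[OF b kN] using True diag by (simp add: mutB_def)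
      qed
      also have "\<dots> = - (d k * mutE k B k i)"
        by (simp add: bform_uminus_left compatible_bform[OF compat ex k])
      finally show ?thesis using True diag by (auto simp: mutE_def)
    next
      case False
      have "bform N lam (\<lambda>b. \<Sum>a\<in>{1..N}. mutB k B a j * mutE k B b a) ?E
          = bform N lam (\<lambda>b. B b j + max 0 (B k j) * B b k) ?E"
      proof (intro bform_cong refl)
        fix b assume b: "b \<in> {1..N}"
        show "(\<Sum>a\<in>{1..N}. mutB k B a j * mutE k B b a) = B b j + max 0 (B k j) * B b k"
        proof (cases "b = k")
          case True
          then show ?thesis using diag unfolding sum_mutE[OF b kN] by (simp add: mutB_def)
        next
          case bk: False
          have "mutB k B k j * max 0 (- B b k) = (max 0 (- B k j) - max 0 (B k j)) * max 0 (- B b k)"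
            "B b k * max 0 (B k j) = (max 0 (B b k) - max 0 (- B b k)) * max 0 (B k j)"
            by (auto simp: mutB_def max_def)
          then show ?thesis
            unfolding sum_mutE[OF b kN] mutB_other[OF bk False] using bk by (simp add: algebra_simps)
        qed
      qed
      also have "\<dots> = d j * mutE k B j i + max 0 (B k j) * (d k * mutE k B k i)"
        by (simp add: bform_add_left bform_scale_left compatible_bform[OF compat ex k] compatible_bform[OF compat ex j])
      \<comment> \<open>For \<open>i = k\<close> the two terms cancel, by skew-symmetry for the pair
        \<open>k\<close>, \<open>j\<close> applied to positive parts.\<close>
      also have "\<dots> = (if i = j then d j else 0)"
        using False scale[OF skew(1)[OF k j] k j] by (auto simp: mutE_def algebra_simps)
      finally show ?thesis .
    qed
    finally show "(\<Sum>a\<in>{1..N}. mutB k B a j * mutLam N k B lam a i) = (if i = j then d j else 0)" .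
  }
qed

section \<open>Mutation of the variables of a seed\<close>

locale cluster_seed = central_unit c for c :: "'a::division_ring" +
  fixes N :: nat and ex :: "nat set" and d :: "nat \<Rightarrow> int"
    and x :: "nat \<Rightarrow> 'a" and lam B :: "nat \<Rightarrow> nat \<Rightarrow> int"
  assumes ex_subset: "ex \<subseteq> {1..N}"
    and skew_lam: "skew_int N lam"
    and compat: "compatible N ex B lam d"
    and qc: "quasi_commuting N lam x"
    and indep: "independent N (frame_val N c lam x)"
begin

abbreviation "M \<equiv> frame_val N c lam x"

lemma frame_M: "frame N lam M"
  by (rule frame_frame_val[OF skew_lam qc])

lemma x_nonzero: "i \<in> {1..N} \<Longrightarrow> x i \<noteq> 0"
  using qc by (rule quasi_commuting_nonzero)

definition exch_pos :: "nat \<Rightarrow> nat \<Rightarrow> int" where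
  "exch_pos k = (\<lambda>i. - unitv k i + bpos N B k i)"

definition exch_neg :: "nat \<Rightarrow> nat \<Rightarrow> int" where
  "exch_neg k = (\<lambda>i. - unitv k i - bneg N B k i)"

lemma mutX_eq: "mutX N c lam B k x = x(k := M (exch_pos k) + M (exch_neg k))"
  by (simp add: mutX_def exch_pos_def exch_neg_def)

context
  fixes k :: nat
  assumes k: "k \<in> ex"
begin

abbreviation "x' \<equiv> mutX N c lam B k x"
abbreviation "lam' \<equiv> mutLam N k B lam"
abbreviation "M' \<equiv> frame_val N c lam' x'"

lemma k_range: "k \<in> {1..N}"
  using ex_subset k by blast

lemma exch_zvec: "exch_pos k \<in> zvec N" "exch_neg k \<in> zvec N"
  using k_range by (auto simp: zvec_def exch_pos_def exch_neg_def bpos_def bneg_def unitv_def)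

lemma exch_k: "exch_pos k k = -1" "exch_neg k k = -1"
  using compatible_diag[OF compat k] by (auto simp: exch_pos_def exch_neg_def bpos_def bneg_def unitv_def)

lemma exch_other_nonneg: "i \<noteq> k \<Longrightarrow> exch_pos k i \<ge> 0" "i \<noteq> k \<Longrightarrow> exch_neg k i \<ge> 0"
  by (auto simp: exch_pos_def exch_neg_def bpos_def bneg_def unitv_def)

text \<open>The two exchange exponents differ by column \<open>k\<close> of \<open>B\<close>, which
  the form sees only through coordinate \<open>k\<close>. So both exchange monomials commute alike
  with every other variable, yet their exponents are distinct as \<open>d k > 0\<close>.\<close>

lemma bform_exch_pos: "bform N lam (exch_pos k) g = bform N lam (exch_neg k) g + d k * g k"
proof -
  have "bform N lam (exch_pos k) g = bform N lam (\<lambda>i. exch_neg k i + B i k) g"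
    by (rule bform_cong) (auto simp: exch_pos_def exch_neg_def bpos_def bneg_def max_def min_def)
  then show ?thesis
    by (simp add: bform_add_left compatible_bform[OF compat ex_subset k])
qed

text \<open>Within the range, column \<open>k\<close> of \<open>mutE k B\<close> is
  \<open>exch_neg k\<close>.\<close>

lemma mutLam_k: "i \<in> {1..N} \<Longrightarrow> i \<noteq> k \<Longrightarrow> lam' k i = bform N lam (exch_neg k) (unitv i)"
  unfolding mutLam_eq_bform mutE_other
  by (rule bform_cong) (use compatible_diag[OF compat k] in \<open>auto simp: mutE_def exch_neg_def bneg_def unitv_def max_def min_def\<close>)

lemma x'_k: "x' k = M (exch_pos k) + M (exch_neg k)"
  by (simp add: mutX_eq)

lemma x'_other: "i \<noteq> k \<Longrightarrow> x' i = x i"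
  by (simp add: mutX_eq)

lemma x'_k_nonzero: "x' k \<noteq> 0"
proof
  assume "x' k = 0"
  have "exch_pos k \<noteq> exch_neg k"
  proof
    assume "exch_pos k = exch_neg k"
    then have "d k = 0" using bform_exch_pos[of "unitv k"] by (simp add: unitv_def)
    then show False using compat k by (auto simp: compatible_def)
  qed
  moreover from this have "(\<Sum>f\<in>{exch_pos k, exch_neg k}. 1 * M f) = 0"
    using \<open>x' k = 0\<close> by (simp add: x'_k)
  ultimately have "(1::'a) = 0"
    using independentD[OF indep, of "{exch_pos k, exch_neg k}" "\<lambda>_. 1" "exch_pos k"] exch_zvec
    by (simp add: subring_gen.one)
  then show False by simp
qed

lemma x'_k_commute:
  assumes i: "i \<in> {1..N}" "i \<noteq> k"
  shows "x' k * x i = c powi (2 * lam' k i) * (x i * x' k)"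
proof -
  have unitv_k: "unitv i k = 0" using i(2) by (simp add: unitv_def)
  have "M f * x i = c powi (2 * lam' k i) * (x i * M f)" if "f \<in> {exch_pos k, exch_neg k}" for f
  proof -
    have "bform N lam f (unitv i) = lam' k i" "f \<in> zvec N"
      using that i exch_zvec bform_exch_pos[of "unitv i"] unitv_k by (auto simp: mutLam_k)
    then show ?thesis
      using frame_commute[OF skew_lam frame_M _ zvec_unitv[OF i(1)], of f] by (simp add: frame_val_unitv[OF i(1)])
  qed
  then show ?thesis
    unfolding x'_k by (simp add: distrib_left distrib_right)
qed

lemma quasi_commuting_mutation: "quasi_commuting N lam' x'"
  unfolding quasi_commuting_def
proof (intro conjI ballI)
  fix i assume "i \<in> {1..N}"
  then show "x' i \<noteq> 0"
    using x'_k_nonzero x_nonzero x'_other by (cases "i = k") auto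
next
  fix i j assume i: "i \<in> {1..N}" and j: "j \<in> {1..N}"
  have skew': "lam' i j = - lam' j i" if "i \<in> {1..N}" "j \<in> {1..N}" for i j
    using skew_int_mutLam[OF skew_lam] that unfolding skew_int_def by blast
  consider "i \<noteq> k" "j \<noteq> k" | "i = k" "j = k" | "i = k" "j \<noteq> k" | "i \<noteq> k" "j = k" by blast
  then show "x' i * x' j = c powi (2 * lam' i j) * (x' j * x' i)"
  proof cases
    case 1
    then show ?thesis
      unfolding x'_other[OF 1(1)] x'_other[OF 1(2)] mutLam_other[OF 1 i j] by (intro quasi_commutingD[OF qc] i j)
  next
    case 2
    have "lam' k k = 0" using skew'[OF k_range k_range] by simp
    then show ?thesis using 2 by simp
  next
    case 3
    then show ?thesis using x'_k_commute[OF j] by (simp add: x'_other)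
  next
    case 4
    show ?thesis
      unfolding 4(2) x'_other[OF 4(1)] x'_k_commute[OF i 4(1)] skew'[OF i k_range] by simp
  qed
qed

lemma x'_k_power_mono_span: "x' k ^ n \<in> mono_span M {f \<in> zvec N. f k = - int n}"
proof (induction n)
  case 0
  have "1 * M (\<lambda>i. 0) \<in> mono_span M {f \<in> zvec N. f k = - int 0}"
    by (intro mono_span_term subring_gen.one) simp
  then show ?case using frame_zero[OF frame_M] by simp
next
  case (Suc n)
  have "1 * M (exch_pos k) + (1 * M (exch_neg k) + 0) \<in> mono_span M {f \<in> zvec N. f k = -1}"
    using exch_zvec exch_k by (intro mono_span.intros subring_gen.one) auto
  then have "x' k \<in> mono_span M {f \<in> zvec N. f k = -1}"
    by (simp add: x'_k)
  then have "x' k * x' k ^ n \<in> mono_span M {f \<in> zvec N. f k = - int (Suc n)}"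
    by (intro mono_span_mult[OF frame_M _ _ _ _ Suc.IH, where F = "{f \<in> zvec N. f k = -1}"]) (auto intro: zvec_add)
  then show ?case by simp
qed

text \<open>Splits off the new variable on the right. The remaining monomial does not involve index
  \<open>k\<close>, the only place where the two seeds differ, so it is an old monomial.\<close>

lemma M'_split:
  assumes "f \<in> zvec N"
  shows "M' f = c powi (- bform N lam' (f(k := 0)) (\<lambda>i. f k * unitv k i)) * (M (f(k := 0)) * x' k powi f k)"
proof -
  let ?g = "f(k := 0)" and ?v = "\<lambda>i. f k * unitv k i"
  have frame': "frame N lam' M'"
    by (rule frame_frame_val[OF skew_int_mutLam[OF skew_lam] quasi_commuting_mutation])
  have z: "?g \<in> zvec N" "?v \<in> zvec N"
    using assms k_range by (auto simp: zvec_def unitv_def)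
  have "(\<lambda>i. ?g i + ?v i) = f"
    by (rule ext) (simp add: unitv_def)
  then have "M' ?g * M' ?v = c powi bform N lam' ?g ?v * M' f"
    using frame_mult[OF frame' z] by simp
  moreover have "M' ?v = x' k powi f k"
    using frame_powi[OF skew_int_mutLam[OF skew_lam] frame' zvec_unitv[OF k_range], of "f k"]
    by (simp add: frame_val_unitv[OF k_range])
  moreover have "M' ?g = M ?g"
    by (rule frame_val_cong) (auto simp: x'_other mutLam_other split: if_splits)
  ultimately show ?thesis by simp
qed

lemma independent_mutation: "independent N M'"
  unfolding independent_def
proof (intro allI impI ballI)
  fix S u f
  assume S: "finite S" "S \<subseteq> zvec N" and u: "\<forall>f\<in>S. u f \<in> coeffs"
    and sum0: "(\<Sum>f\<in>S. u f * M' f) = 0" and f: "f \<in> S"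
  let ?e = "\<lambda>f. - bform N lam' (f(k := 0)) (\<lambda>i. f k * unitv k i)"
  define v where "v f = u f * c powi ?e f" for f
  have v: "v f \<in> coeffs" if "f \<in> S" for f
    using u that by (auto simp: v_def intro!: subring_gen.mult coeffs_powi)
  \<comment> \<open>A bound for all exponents of the new variable: multiplying the relation by
    \<open>x' k powi m\<close> leaves only nonnegative powers, which lie in the span of old
    monomials.\<close>
  define m where "m = Max ((\<lambda>f. \<bar>f k\<bar>) ` S)"
  have m: "f k + m \<ge> 0" if "f \<in> S" for f
  proof -
    have "\<bar>f k\<bar> \<le> m" unfolding m_def using S(1) that by (intro Max_ge) auto
    then show ?thesis by simp
  qed
  \<comment> \<open>The index \<open>n\<close> is the degree in the old variable \<open>x k\<close>.
    It is minus the power of \<open>x' k\<close>, since the new variable has degree -1.\<close>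
  define T where "T n = {f \<in> S. f k + m = - n}" for n
  define H where "H n = (\<Sum>f\<in>T n. v f * M (f(k := 0)))" for n
  define I where "I = (\<lambda>f. - (f k + m)) ` S"
  have "(\<Sum>f\<in>S. v f * M (f(k := 0)) * x' k powi (f k + m)) = (\<Sum>f\<in>S. u f * M' f) * x' k powi m"
    unfolding sum_distrib_right
  proof (intro sum.cong refl)
    fix f assume "f \<in> S"
    then have "f \<in> zvec N" using S by blast
    show "v f * M (f(k := 0)) * x' k powi (f k + m) = u f * M' f * x' k powi m"
      unfolding v_def M'_split[OF \<open>f \<in> zvec N\<close>] using x'_k_nonzero
      by (simp add: power_int_add mult.assoc)
  qed
  then have "0 = (\<Sum>n\<in>I. \<Sum>f | f \<in> S \<and> - (f k + m) = n. v f * M (f(k := 0)) * x' k powi (f k + m))"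
    unfolding sum0 I_def sum.image_gen[OF S(1), of _ "\<lambda>f. - (f k + m)"] by simp
  also have "\<dots> = (\<Sum>n\<in>I. H n * x' k powi (- n))"
    unfolding H_def sum_distrib_right T_def by (intro sum.cong) auto
  finally have graded: "(\<Sum>n\<in>I. H n * x' k powi (- n)) = 0" by simp
  have "H n * x' k powi (- n) \<in> mono_span M {f \<in> zvec N. f k = n}" if "n \<in> I" for n
  proof -
    have "n \<le> 0" using that m by (force simp: I_def)
    then have "x' k powi (- n) = x' k ^ nat (- n)" "- int (nat (- n)) = n"
      by (simp_all add: power_int_def)
    then have "x' k powi (- n) \<in> mono_span M {f \<in> zvec N. f k = n}"
      using x'_k_power_mono_span[of "nat (- n)"] by simp
    moreover have "H n \<in> mono_span M {f \<in> zvec N. f k = 0}"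
      unfolding H_def T_def using v S(2)
      by (intro mono_span_sum mono_span_term) (auto simp: zvec_def)
    ultimately show ?thesis
      by (intro mono_span_mult[OF frame_M, where F = "{f \<in> zvec N. f k = 0}" and G = "{f \<in> zvec N. f k = n}"])
        (auto simp: zvec_def)
  qed
  from graded_sum_eq_0[OF indep _ this graded] S(1)
  have H0: "H n = 0" if "n \<in> I" for n
    using that x'_k_nonzero unfolding I_def by (metis (no_types, lifting) finite_imageI mult_eq_0_iff power_int_eq_0_iff)
  define n where "n = - (f k + m)"
  \<comment> \<open>Within \<open>T n\<close> the coordinate at \<open>k\<close> is fixed, so
    erasing it loses nothing and \<open>H n = 0\<close> is a relation between distinct old
    monomials.\<close>
  have inj: "inj_on (\<lambda>f. f(k := 0)) (T n)"
  proof (rule inj_onI)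
    fix g h assume gh: "g \<in> T n" "h \<in> T n" "g(k := 0) = h(k := 0)"
    show "g = h"
    proof
      fix i
      show "g i = h i"
        using gh(1,2) fun_cong[OF gh(3), of i] by (cases "i = k") (simp_all add: T_def)
    qed
  qed
  let ?inv = "the_inv_into (T n) (\<lambda>f. f(k := 0))"
  have "(\<Sum>g\<in>(\<lambda>f. f(k := 0)) ` T n. v (?inv g) * M g) = H n"
    unfolding H_def sum.reindex[OF inj] by (intro sum.cong refl) (simp add: the_inv_into_f_f[OF inj])
  also have "H n = 0"
    using H0 f by (auto simp: n_def I_def)
  finally have "v (?inv (f(k := 0))) = 0"
  proof (rule independentD[OF indep, rotated 3])
    show "finite ((\<lambda>f. f(k := 0)) ` T n)" using S(1) by (simp add: T_def)
    show "(\<lambda>f. f(k := 0)) ` T n \<subseteq> zvec N" using S(2) by (auto simp: T_def zvec_def)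
    show "v (?inv g) \<in> coeffs" if g: "g \<in> (\<lambda>f. f(k := 0)) ` T n" for g
    proof -
      obtain h where "h \<in> T n" "g = h(k := 0)" using g by blast
      then show ?thesis using v[of h] by (simp add: the_inv_into_f_f[OF inj]) (simp add: T_def)
    qed
    show "f(k := 0) \<in> (\<lambda>f. f(k := 0)) ` T n" using f by (auto simp: T_def n_def)
  qed
  moreover have "f \<in> T n" using f by (simp add: T_def n_def)
  ultimately show "u f = 0"
    using c_nonzero by (simp add: the_inv_into_f_f[OF inj] v_def)
qed

lemma cluster_seed_mutation: "cluster_seed c N ex d x' lam' (mutB k B)"
  by unfold_locales
    (intro ex_subset skew_int_mutLam skew_lam compatible_mutation compat k quasi_commuting_mutation independent_mutation)+

end

end

section \<open>Mixed quantum tori as spans of monomials\<close>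

definition tge_exponents :: "nat \<Rightarrow> nat set \<Rightarrow> nat set \<Rightarrow> (nat \<Rightarrow> int) set" where
  "tge_exponents N ex iv = {f \<in> zvec N. \<forall>i\<in>{1..N} - (ex \<union> iv). f i \<ge> 0}"

text \<open>Products of generators can be reordered up to powers of \<open>c\<close>, so the
  generated ring is spanned by monomials. Conversely, a negative exponent is allowed just where the
  inverse variable is a generator.\<close>

lemma (in cluster_seed) Tge_eq_mono_span:
  assumes "iv \<subseteq> {1..N}"
  shows "Tge N c ex iv x = mono_span M (tge_exponents N ex iv)"
proof (intro equalityI subsetI)
  fix a assume "a \<in> Tge N c ex iv x"
  then show "a \<in> mono_span M (tge_exponents N ex iv)"
    unfolding Tge_def
  proof induction
    case (gen a)
    have unit: "1 * M f = M f" "u * M (\<lambda>i. 0) = u" for f u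
      using frame_zero[OF frame_M] by simp_all
    have zero: "(\<lambda>i. 0) \<in> tge_exponents N ex iv"
      by (simp add: tge_exponents_def)
    consider "a \<in> {c, inverse c}" | i where "i \<in> {1..N}" "a = x i" | j where "j \<in> ex \<union> iv" "a = inverse (x j)"
      using gen by blast
    then show ?case
    proof cases
      case 1
      then show ?thesis
        using mono_span_term[OF subring_gen.gen[OF 1] zero, of M] by (simp only: unit)
    next
      case 2
      then have "unitv i \<in> tge_exponents N ex iv" "M (unitv i) = a"
        by (simp_all add: tge_exponents_def zvec_unitv frame_val_unitv) (simp add: unitv_def)
      then show ?thesis
        using mono_span_term[OF subring_gen.one, of "unitv i" _ M] by simp
    next
      case 3
      then have j: "j \<in> {1..N}"
        using ex_subset assms by blast
      let ?v = "\<lambda>i. - unitv j i"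
      have z: "unitv j \<in> zvec N" "?v \<in> zvec N"
        using zvec_unitv[OF j] zvec_uminus[OF zvec_unitv[OF j]] by simp_all
      have "M (unitv j) * M ?v = 1"
        using frame_mult[OF frame_M z] frame_zero[OF frame_M] bform_skew[OF skew_lam, of "unitv j" ?v]
        by (simp add: bform_uminus_left skew_lam)
      then have "inverse (M (unitv j)) = M ?v"
        by (rule inverse_unique)
      then have "a = M ?v"
        using 3 by (simp add: frame_val_unitv[OF j])
      moreover have "?v \<in> tge_exponents N ex iv"
        using 3 z by (auto simp: tge_exponents_def unitv_def)
      ultimately show ?thesis
        using mono_span_term[OF subring_gen.one, of ?v _ M] by (simp only: unit)
    qed
  next
    case one
    have "1 * M (\<lambda>i. 0) \<in> mono_span M (tge_exponents N ex iv)"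
      by (intro mono_span_term subring_gen.one) (simp add: tge_exponents_def)
    then show ?case using frame_zero[OF frame_M] by simp
  next
    case (mult a b)
    show ?case
      by (rule mono_span_mult[OF frame_M _ _ _ mult.IH]) (auto simp: tge_exponents_def intro: add_nonneg_nonneg)
  qed (auto intro: mono_span_add mono_span_uminus)
next
  fix a assume "a \<in> mono_span M (tge_exponents N ex iv)"
  then show "a \<in> Tge N c ex iv x"
    unfolding Tge_def
  proof induction
    case (step u f h)
    let ?G = "{c, inverse c} \<union> x ` {1..N} \<union> (\<lambda>j. inverse (x j)) ` (ex \<union> iv)"
    have "u \<in> subring_gen ?G"
      using subring_gen_least[of "{c, inverse c}" ?G] step(1) by (auto intro: subring_gen.gen)
    moreover have "c powi n \<in> subring_gen ?G" for n
      by (rule subring_gen_power_int) (auto intro: subring_gen.gen)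
    moreover have "oprod N x f \<in> subring_gen ?G"
    proof (rule oprod_mem_subring_gen)
      fix i assume "i \<in> {1..N}"
      then show "x i \<in> subring_gen ?G" by (intro subring_gen.gen) simp
      show "f i \<ge> 0 \<or> inverse (x i) \<in> subring_gen ?G"
        using step(2) \<open>i \<in> {1..N}\<close> unfolding tge_exponents_def by (auto intro!: subring_gen.gen)
    qed
    ultimately show ?case
      using step.IH unfolding frame_val_def by (intro subring_gen.add subring_gen.mult)
  qed (rule subring_gen_zero)
qed

lemma Tge_one: "1 \<in> Tge N c ex iv x"
  unfolding Tge_def by (rule subring_gen.one)

lemma Tge_zero: "0 \<in> Tge N c ex iv x"
  unfolding Tge_def by (rule subring_gen_zero)

lemma Tge_mult: "a \<in> Tge N c ex iv x \<Longrightarrow> b \<in> Tge N c ex iv x \<Longrightarrow> a * b \<in> Tge N c ex iv x"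
  unfolding Tge_def by (rule subring_gen.mult)

lemma Tge_uminus: "a \<in> Tge N c ex iv x \<Longrightarrow> - a \<in> Tge N c ex iv x"
  unfolding Tge_def by (rule subring_gen.neg)

lemma Tge_sum: "(\<And>i. i \<in> I \<Longrightarrow> h i \<in> Tge N c ex iv x) \<Longrightarrow> sum h I \<in> Tge N c ex iv x"
  unfolding Tge_def by (rule subring_gen_sum)

lemma Tge_power: "a \<in> Tge N c ex iv x \<Longrightarrow> a ^ n \<in> Tge N c ex iv x"
  unfolding Tge_def by (rule subring_gen_power)

section \<open>Seeds from toric frames\<close>

lemma q_toric_frame_imp_eps_toric_frame: "q_toric_frame N c lam X \<Longrightarrow> eps_toric_frame N c lam X"
  unfolding q_toric_frame_def eps_toric_frame_def
proof (elim conjE, intro conjI allI impI ballI)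
  fix S :: "(nat \<Rightarrow> int) set" and p f
  assume "\<forall>S p. finite S \<longrightarrow> S \<subseteq> zvec N \<longrightarrow> (\<Sum>f\<in>S. ipoly (p f) c * X f) = 0 \<longrightarrow> (\<forall>f\<in>S. p f = 0)"
    "finite S" "S \<subseteq> zvec N" "(\<Sum>f\<in>S. ipoly (p f) c * X f) = 0" "f \<in> S"
  then have "p f = 0" by blast
  then show "ipoly (p f) c = 0" by simp
qed blast+

lemma q_toric_frame_nonzero:
  assumes "q_toric_frame N c lam X"
  shows "c \<noteq> 0"
proof
  assume "c = 0"
  then have "(\<Sum>f\<in>{\<lambda>i. 0}. ipoly [:0, 1:] c * X f) = 0"
    by (simp add: ipoly_pCons)
  with assms[unfolded q_toric_frame_def, THEN conjunct2, THEN conjunct1, rule_format, of "{\<lambda>i. 0}" "\<lambda>_. [:0, 1:]"]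
  show False by simp
qed

text \<open>Serves both sides: a quantum frame is first weakened by
  \<open>q_toric_frame_imp_eps_toric_frame\<close>, and strictness supplies one integer pair that is
  compatible in both cases.\<close>

lemma toric_frame_cluster_seed:
  assumes "central c" "c \<noteq> 0" "ex \<subseteq> {1..N}" "skew_int N lam" "compatible N ex B lam d" "eps_toric_frame N c lam X"
  shows "cluster_seed c N ex d (\<lambda>i. X (unitv i)) lam B"
proof -
  interpret central_unit c
    by unfold_locales (fact assms)+
  have frame: "frame N lam X"
    by (rule toric_frame_frame) fact
  show ?thesis
  proof
    show "quasi_commuting N lam (\<lambda>i. X (unitv i))"
      unfolding quasi_commuting_def
    proof (intro conjI ballI)
      fix i j assume "i \<in> {1..N}" "j \<in> {1..N}"
      then show "X (unitv i) * X (unitv j) = c powi (2 * lam i j) * (X (unitv j) * X (unitv i))"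
        using frame_commute[OF assms(4) frame zvec_unitv zvec_unitv, of i j] bform_unitv_unitv[of i N j lam]
        by presburger
    qed (intro frame_nonzero[OF frame] zvec_unitv)
    show "independent N (frame_val N c lam (\<lambda>i. X (unitv i)))"
      unfolding independent_def
    proof (intro allI impI ballI)
      fix S u f
      assume S: "finite S" "S \<subseteq> zvec N" "\<forall>f\<in>S. u f \<in> coeffs" "f \<in> S"
        and "(\<Sum>f\<in>S. u f * frame_val N c lam (\<lambda>i. X (unitv i)) f) = 0"
      then have "(\<Sum>f\<in>S. u f * X f) = 0"
        using frame_eq_frame_val[OF assms(4) frame] by (simp add: subset_iff)
      then show "u f = 0"
        using independentD[OF toric_frame_independent[OF assms(6)], of S u f] S by blast
    qed
  qed (fact assms)+
qed

lemma cluster_seed_seeds: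
  assumes "cluster_seed c N ex d x lam B" "s \<in> seeds N c ex (x, lam, B)"
  shows "cluster_seed c N ex d (fst s) (fst (snd s)) (snd (snd s))"
  using assms(2)
proof induction
  case (step s k)
  then show ?case
    using cluster_seed.cluster_seed_mutation[OF step.IH step(2)] by (simp add: mutseed_def case_prod_beta)
qed (use assms(1) in simp)

section \<open>Specialization\<close>

text \<open>Strictness enters through the shared integer data: both seeds carry the same
  \<open>lam\<close>, \<open>B\<close> and \<open>d\<close>, so a sequence of mutations acts on them
  in parallel and only the variables have to be compared.\<close>

locale seed_specialization =
  Q: cluster_seed t N ex d xq lam B + E: cluster_seed z N ex d xe lam B
  for t :: "'q::division_ring" and z :: "'e::division_ring"
    and N ex d xq xe lam B +
  fixes iv :: "nat set" and \<kappa> :: "'q \<Rightarrow> 'e"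
  assumes iv_subset: "iv \<subseteq> {1..N}"
    and hom: "a \<in> Tge N t ex iv xq \<Longrightarrow> b \<in> Tge N t ex iv xq \<Longrightarrow> \<kappa> (a + b) = \<kappa> a + \<kappa> b \<and> \<kappa> (a * b) = \<kappa> a * \<kappa> b"
    and \<kappa>_one: "\<kappa> 1 = 1" and \<kappa>_t: "\<kappa> t = z"
    and \<kappa>_x: "i \<in> {1..N} \<Longrightarrow> \<kappa> (xq i) = xe i"
    and clalg_eq_upper: "clalg N t ex iv (xq, lam, B) = upper N t ex iv (xq, lam, B)"
begin

abbreviation "\<T> \<equiv> Tge N t ex iv xq"
abbreviation "\<A> \<equiv> clalg N t ex iv (xq, lam, B)"

lemma t_mem: "t \<in> \<T>" "inverse t \<in> \<T>"
  by (auto simp: Tge_def intro: subring_gen.gen)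

lemma \<kappa>_add: "a \<in> \<T> \<Longrightarrow> b \<in> \<T> \<Longrightarrow> \<kappa> (a + b) = \<kappa> a + \<kappa> b"
  and \<kappa>_mult: "a \<in> \<T> \<Longrightarrow> b \<in> \<T> \<Longrightarrow> \<kappa> (a * b) = \<kappa> a * \<kappa> b"
  using hom by blast+

lemma \<kappa>_zero: "\<kappa> 0 = 0"
  using \<kappa>_add[OF Tge_zero Tge_zero] by simp

lemma \<kappa>_inverse:
  assumes "a \<in> \<T>" "inverse a \<in> \<T>"
  shows "\<kappa> (inverse a) = inverse (\<kappa> a)"
proof (cases "a = 0")
  case False
  then have "\<kappa> a * \<kappa> (inverse a) = 1"
    using \<kappa>_mult[OF assms] \<kappa>_one by simp
  then show ?thesis
    by (rule inverse_unique[symmetric])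
qed (simp add: \<kappa>_zero)

lemma \<kappa>_sum: "(\<And>i. i \<in> I \<Longrightarrow> h i \<in> \<T>) \<Longrightarrow> \<kappa> (sum h I) = (\<Sum>i\<in>I. \<kappa> (h i))"
  by (induction I rule: infinite_finite_induct) (auto simp: \<kappa>_zero \<kappa>_add Tge_sum)

lemma \<kappa>_power: "a \<in> \<T> \<Longrightarrow> \<kappa> (a ^ n) = \<kappa> a ^ n"
  by (induction n) (auto simp: \<kappa>_one \<kappa>_mult Tge_power)

lemma \<kappa>_t_powi: "\<kappa> (t powi n) = z powi n"
  using t_mem by (simp add: power_int_def \<kappa>_power \<kappa>_inverse \<kappa>_t)

lemma coeffs_subset: "Q.coeffs \<subseteq> \<T>"
  unfolding Tge_def by (rule subring_gen_least) (auto intro: subring_gen.gen)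

lemma \<kappa>_coeffs: "u \<in> Q.coeffs \<Longrightarrow> \<kappa> u \<in> E.coeffs"
proof (induction rule: subring_gen.induct)
  case (gen a)
  then show ?case using t_mem by (auto simp: \<kappa>_t \<kappa>_inverse intro: subring_gen.gen)
next
  case (neg a)
  have "\<kappa> (a + - a) = \<kappa> a + \<kappa> (- a)"
    using coeffs_subset neg(1) by (intro \<kappa>_add Tge_uminus) auto
  then have "\<kappa> (- a) = - \<kappa> a"
    by (simp add: \<kappa>_zero eq_neg_iff_add_eq_0 add.commute)
  then show ?case using neg.IH by (simp add: subring_gen.neg)
next
  case (add a b)
  then have "\<kappa> (a + b) = \<kappa> a + \<kappa> b" using coeffs_subset by (intro \<kappa>_add) auto
  then show ?case using add.IH by (simp add: subring_gen.add)
next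
  case (mult a b)
  then have "\<kappa> (a * b) = \<kappa> a * \<kappa> b" using coeffs_subset by (intro \<kappa>_mult) auto
  then show ?case using mult.IH by (simp add: subring_gen.mult)
qed (simp add: \<kappa>_one subring_gen.one)

text \<open>Nonnegative exponents keep every factor inside \<open>\<T>\<close>, where
  \<open>\<kappa>\<close> is known to be multiplicative. The variables may be any elements of
  \<open>\<T>\<close>, in particular those of another seed.\<close>

lemma \<kappa>_frame_val:
  assumes x: "\<And>i. i \<in> {1..N} \<Longrightarrow> x i \<in> \<T>" "\<And>i. i \<in> {1..N} \<Longrightarrow> y i = \<kappa> (x i)"
    and f: "\<And>i. i \<in> {1..N} \<Longrightarrow> f i \<ge> 0"
  shows "frame_val N t l x f \<in> \<T>" "\<kappa> (frame_val N t l x f) = frame_val N z l y f"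
proof -
  have "oprod n x f \<in> \<T> \<and> \<kappa> (oprod n x f) = oprod n y f" if "n \<le> N" for n
    using that
  proof (induction n)
    case 0
    show ?case by (simp add: \<kappa>_one Tge_one)
  next
    case (Suc n)
    then have n: "Suc n \<in> {1..N}" by simp
    have "x (Suc n) powi f (Suc n) \<in> \<T>" "\<kappa> (x (Suc n) powi f (Suc n)) = y (Suc n) powi f (Suc n)"
      using x(1)[OF n] x(2)[OF n] f[OF n] by (simp_all add: power_int_def \<kappa>_power Tge_power)
    then show ?case
      using Suc by (simp add: oprod_Suc \<kappa>_mult Tge_mult)
  qed
  moreover have "t powi n \<in> \<T>" for n
    using Q.coeffs_powi coeffs_subset by blast
  ultimately show "frame_val N t l x f \<in> \<T>" "\<kappa> (frame_val N t l x f) = frame_val N z l y f"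
    unfolding frame_val_def by (auto simp: \<kappa>_mult \<kappa>_t_powi intro: Tge_mult)
qed

text \<open>The initial seed is one of those over which the intersection runs, so equality with the
  upper algebra puts every cluster variable into the domain of \<open>\<kappa>\<close>.\<close>

lemma \<A>_subset: "\<A> \<subseteq> \<T>"
  unfolding clalg_eq_upper upper_def using seeds.init[of "(xq, lam, B)"] by fastforce

lemma cluster_variable_mem: "s \<in> seeds N t ex (xq, lam, B) \<Longrightarrow> i \<in> {1..N} \<Longrightarrow> fst s i \<in> \<T>"
  by (rule subsetD[OF \<A>_subset], unfold clalg_def, rule subring_gen.gen) blast

text \<open>The exchange relation is used in the form \<open>x k * x' k = \<dots>\<close>, whose right-hand side involves only
  nonnegative powers, because \<open>\<kappa>\<close> need not be defined at the inverse of \<open>x k\<close>.\<close>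
lemma \<kappa>_mutX:
  assumes sq: "(x, l, b) \<in> seeds N t ex (xq, lam, B)" and se: "(y, l, b) \<in> seeds N z ex (xe, lam, B)"
    and y: "\<And>i. i \<in> {1..N} \<Longrightarrow> y i = \<kappa> (x i)" and k: "k \<in> ex" and i: "i \<in> {1..N}"
  shows "mutX N z l b k y i = \<kappa> (mutX N t l b k x i)"
proof -
  interpret q: cluster_seed t N ex d x l b
    using cluster_seed_seeds[OF Q.cluster_seed_axioms sq] by simp
  interpret e: cluster_seed z N ex d y l b
    using cluster_seed_seeds[OF E.cluster_seed_axioms se] by simp
  have kN: "k \<in> {1..N}" using k Q.ex_subset by blast
  have x: "x i \<in> \<T>" if "i \<in> {1..N}" for i
    using cluster_variable_mem[OF sq that] by simp
  show ?thesis
  proof (cases "i = k")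
    case False
    then show ?thesis using y[OF i] by (simp add: mutX_def)
  next
    case True
    let ?f = "q.exch_pos k" and ?g = "q.exch_neg k"
    have exchange: "x k * q.M f \<in> \<T>" "\<kappa> (x k * q.M f) = y k * e.M f" if f: "f \<in> {?f, ?g}" for f
    proof -
      \<comment> \<open>Since \<open>f k = -1\<close> and all other entries are nonnegative, adding
        \<open>unitv k\<close> gives an exponent to which \<open>\<kappa>_frame_val\<close>
        applies.\<close>
      define h where "h = (\<lambda>i. unitv k i + f i)"
      define m where "m = bform N l (unitv k) f"
      have fz: "f \<in> zvec N" and nonneg: "h i \<ge> 0" for i
        using f q.exch_zvec[OF k] q.exch_k[OF k] q.exch_other_nonneg[OF k, of i]
        by (auto simp: h_def unitv_def)
      have "x k * q.M f = t powi m * q.M h"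
        using Q.frame_mult[OF q.frame_M zvec_unitv[OF kN] fz] by (simp add: Q.frame_val_unitv[OF kN] m_def h_def)
      moreover have "y k * e.M f = z powi m * e.M h"
        using E.frame_mult[OF e.frame_M zvec_unitv[OF kN] fz] by (simp add: E.frame_val_unitv[OF kN] m_def h_def)
      moreover have "t powi m \<in> \<T>"
        using Q.coeffs_powi coeffs_subset by blast
      ultimately show "x k * q.M f \<in> \<T>" "\<kappa> (x k * q.M f) = y k * e.M f"
        using \<kappa>_frame_val[of x y h l, OF x y nonneg] by (simp_all add: \<kappa>_mult \<kappa>_t_powi Tge_mult)
    qed
    \<comment> \<open>The sum of the exchange monomials is a cluster variable of the mutated seed
      and hence lies in \<open>\<T>\<close>, although the separate summands need not.\<close>
    have "mutseed N t k (x, l, b) \<in> seeds N t ex (xq, lam, B)"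
      using sq k by (rule seeds.step)
    from cluster_variable_mem[OF this kN] have x': "q.M ?f + q.M ?g \<in> \<T>"
      by (simp add: mutseed_def q.mutX_eq)
    have "y k * \<kappa> (q.M ?f + q.M ?g) = \<kappa> (x k * q.M ?f + x k * q.M ?g)"
      using \<kappa>_mult[OF x[OF kN] x'] y[OF kN] by (simp add: distrib_left)
    also have "\<dots> = y k * (e.M ?f + e.M ?g)"
      using exchange by (simp add: \<kappa>_add distrib_left)
    finally have "\<kappa> (q.M ?f + q.M ?g) = e.M ?f + e.M ?g"
      using e.x_nonzero[OF kN] by simp
    then show ?thesis
      using True by (simp add: q.mutX_eq e.mutX_eq)
  qed
qed

text \<open>The same mutations are applied on the root of unity side. Agreement is claimed only at
  indices in \<open>{1..N}\<close>, since \<open>\<kappa>\<close> is not controlled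
  elsewhere.\<close>

lemma seeds_specialize:
  assumes "s \<in> seeds N t ex (xq, lam, B)"
  shows "\<exists>y. (y, snd s) \<in> seeds N z ex (xe, lam, B) \<and> (\<forall>i\<in>{1..N}. y i = \<kappa> (fst s i))"
  using assms
proof induction
  case init
  show ?case using seeds.init[of "(xe, lam, B)" N z ex] \<kappa>_x by (intro exI[of _ xe]) simp
next
  case (step s k)
  obtain x l b where s: "s = (x, l, b)" by (cases s)
  from step.IH s obtain y where y: "(y, l, b) \<in> seeds N z ex (xe, lam, B)" "\<forall>i\<in>{1..N}. y i = \<kappa> (x i)" by auto
  have "mutseed N z k (y, l, b) \<in> seeds N z ex (xe, lam, B)"
    using y(1) step(2) by (rule seeds.step)
  moreover have "mutX N z l b k y i = \<kappa> (mutX N t l b k x i)" if "i \<in> {1..N}" for i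
    using \<kappa>_mutX[OF step(1)[unfolded s] y(1) _ step(2) that] y(2) by blast
  ultimately show ?case
    unfolding s mutseed_def by (intro exI[of _ "mutX N z l b k y"]) simp
qed

text \<open>The converse matching, by which every root of unity cluster variable is exhibited as an
  image.\<close>

lemma seeds_lift:
  assumes "s \<in> seeds N z ex (xe, lam, B)"
  shows "\<exists>x. (x, snd s) \<in> seeds N t ex (xq, lam, B) \<and> (\<forall>i\<in>{1..N}. fst s i = \<kappa> (x i))"
  using assms
proof induction
  case init
  show ?case using seeds.init[of "(xq, lam, B)" N t ex] \<kappa>_x by (intro exI[of _ xq]) simp
next
  case (step s k)
  obtain y l b where s: "s = (y, l, b)" by (cases s)
  from step.IH s obtain x where x: "(x, l, b) \<in> seeds N t ex (xq, lam, B)" "\<forall>i\<in>{1..N}. y i = \<kappa> (x i)" by auto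
  have "mutseed N t k (x, l, b) \<in> seeds N t ex (xq, lam, B)"
    using x(1) step(2) by (rule seeds.step)
  moreover have "mutX N z l b k y i = \<kappa> (mutX N t l b k x i)" if "i \<in> {1..N}" for i
    using \<kappa>_mutX[OF x(1) step(1)[unfolded s] _ step(2) that] x(2) by blast
  ultimately show ?case
    unfolding s mutseed_def by (intro exI[of _ "mutX N t l b k x"]) simp
qed

lemma image_clalg: "\<kappa> ` \<A> = clalg N z ex iv (xe, lam, B)"
proof -
  let ?V = "{fst s i | s i. s \<in> seeds N t ex (xq, lam, B) \<and> i \<in> {1..N}}"
  let ?W = "{fst s i | s i. s \<in> seeds N z ex (xe, lam, B) \<and> i \<in> {1..N}}"
  have "\<kappa> ` ?V = ?W"
  proof (intro equalityI subsetI)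
    fix a assume "a \<in> \<kappa> ` ?V"
    then obtain s i where s: "s \<in> seeds N t ex (xq, lam, B)" "i \<in> {1..N}" "a = \<kappa> (fst s i)" by blast
    from seeds_specialize[OF s(1)] obtain y where
      "(y, snd s) \<in> seeds N z ex (xe, lam, B)" "\<forall>i\<in>{1..N}. y i = \<kappa> (fst s i)" by blast
    then have "a = fst (y, snd s) i" "(y, snd s) \<in> seeds N z ex (xe, lam, B)" using s by simp_all
    then show "a \<in> ?W" using s(2) by blast
  next
    fix a assume "a \<in> ?W"
    then obtain s i where s: "s \<in> seeds N z ex (xe, lam, B)" "i \<in> {1..N}" "a = fst s i" by blast
    from seeds_lift[OF s(1)] obtain x where
      "(x, snd s) \<in> seeds N t ex (xq, lam, B)" "\<forall>i\<in>{1..N}. fst s i = \<kappa> (x i)" by blast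
    then have "a = \<kappa> (fst (x, snd s) i)" "(x, snd s) \<in> seeds N t ex (xq, lam, B)" using s by simp_all
    then show "a \<in> \<kappa> ` ?V" using s(2) by blast
  qed
  moreover have "\<kappa> (inverse t) = inverse z"
    using \<kappa>_inverse[OF t_mem] by (simp add: \<kappa>_t)
  moreover have "\<kappa> ` {inverse (xq j) | j. j \<in> iv} = {inverse (xe j) | j. j \<in> iv}"
  proof -
    have "\<kappa> (inverse (xq j)) = inverse (xe j)" if "j \<in> iv" for j
    proof -
      have "j \<in> {1..N}" using that iv_subset by blast
      moreover have "inverse (xq j) \<in> \<T>" "xq j \<in> \<T>"
        unfolding Tge_def using that iv_subset by (auto intro!: subring_gen.gen)
      ultimately show ?thesis using \<kappa>_inverse[of "xq j"] \<kappa>_x by simp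
    qed
    then show ?thesis unfolding Setcompr_eq_image image_image by (intro image_cong) auto
  qed
  moreover have "\<kappa> (a + b) = \<kappa> a + \<kappa> b \<and> \<kappa> (a * b) = \<kappa> a * \<kappa> b" if "a \<in> \<A>" "b \<in> \<A>" for a b
    using hom that \<A>_subset by blast
  ultimately show ?thesis
    using image_subring_gen[of "{t, inverse t} \<union> ?V \<union> {inverse (xq j) | j. j \<in> iv}" \<kappa>] \<kappa>_one
    by (simp add: clalg_def image_Un \<kappa>_t)
qed

section \<open>The kernel of the specialization\<close>

context
  fixes \<Phi> :: 'q
  assumes \<Phi>_coeffs: "\<Phi> \<in> Q.coeffs"
    and kernel: "{a \<in> \<T>. \<kappa> a = 0} = {\<Phi> * b | b. b \<in> \<T>}"
begin

text \<open>The kernel hypothesis gives a quotient in \<open>\<T>\<close> only; comparing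
  coefficients of the constant monomial shows that the constant coefficient of this quotient already
  does the job.\<close>

lemma coeffs_kernel:
  assumes "u \<in> Q.coeffs" "\<kappa> u = 0"
  shows "\<exists>v\<in>Q.coeffs. u = \<Phi> * v"
proof -
  have "u \<in> {a \<in> \<T>. \<kappa> a = 0}" using assms coeffs_subset by blast
  then obtain b where b: "b \<in> \<T>" "u = \<Phi> * b" unfolding kernel by blast
  then have "b \<in> Q.mono_span Q.M (tge_exponents N ex iv)"
    using Q.Tge_eq_mono_span[OF iv_subset] by blast
  then obtain S w where S: "finite S" "S \<subseteq> tge_exponents N ex iv" "\<And>f. w f \<in> Q.coeffs"
    "\<And>f. f \<notin> S \<Longrightarrow> w f = 0" "b = (\<Sum>f\<in>S. w f * Q.M f)"
    by (rule Q.mono_span_expand) blast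
  \<comment> \<open>\<open>?v\<close> lists the coefficients of \<open>u - \<Phi> * b\<close>, which
    is zero. The exponent \<open>?o\<close> is inserted in case \<open>S\<close> lacks it, which
    changes nothing since \<open>w\<close> vanishes off \<open>S\<close>.\<close>
  let ?o = "\<lambda>i. 0 :: int" and ?v = "\<lambda>f. (if f = (\<lambda>i. 0) then u else 0) - \<Phi> * w f"
  have "b = (\<Sum>f\<in>insert ?o S. w f * Q.M f)"
    unfolding S(5) using S(1,4) by (intro sum.mono_neutral_left) auto
  moreover have "(\<Sum>f\<in>insert ?o S. (if f = ?o then u else 0) * Q.M f) = u * Q.M ?o"
    using S(1) by (simp add: if_distrib[of "\<lambda>a. a * _"] cong: if_cong)
  ultimately have "(\<Sum>f\<in>insert ?o S. ?v f * Q.M f) = u * Q.M ?o - \<Phi> * b"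
    by (simp only: left_diff_distrib sum_subtractf sum_distrib_left mult.assoc)
  also have "\<dots> = 0"
    using Q.frame_zero[OF Q.frame_M] b by simp
  finally have "?v ?o = 0"
  proof (rule Q.independentD[OF Q.indep, rotated 3])
    show "insert ?o S \<subseteq> zvec N" using S(2) by (auto simp: tge_exponents_def)
    show "?v f \<in> Q.coeffs" for f
      using assms(1) S(3) \<Phi>_coeffs by (intro subring_gen_diff subring_gen.mult) (auto simp: subring_gen_zero)
  qed (use S(1) in auto)
  then show ?thesis using S(3) by auto
qed

lemma Tge_kernel:
  assumes s: "(x, l, b) \<in> seeds N t ex (xq, lam, B)"
    and a: "a \<in> Tge N t ex iv x" "a \<in> \<T>" "\<kappa> a = 0"
  shows "\<exists>a'\<in>Tge N t ex iv x. a = \<Phi> * a'"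
proof -
  from seeds_specialize[OF s] obtain y where se: "(y, l, b) \<in> seeds N z ex (xe, lam, B)"
    and y: "\<And>i. i \<in> {1..N} \<Longrightarrow> y i = \<kappa> (x i)" by auto
  interpret q: cluster_seed t N ex d x l b
    using cluster_seed_seeds[OF Q.cluster_seed_axioms s] by simp
  interpret e: cluster_seed z N ex d y l b
    using cluster_seed_seeds[OF E.cluster_seed_axioms se] by simp
  have x: "x i \<in> \<T>" if "i \<in> {1..N}" for i
    using cluster_variable_mem[OF s that] by simp
  have "a \<in> Q.mono_span q.M (tge_exponents N ex iv)"
    using q.Tge_eq_mono_span[OF iv_subset] a(1) by blast
  then obtain S w where S: "finite S" "S \<subseteq> tge_exponents N ex iv" "\<And>f. w f \<in> Q.coeffs"
    "a = (\<Sum>f\<in>S. w f * q.M f)"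
    by (rule Q.mono_span_expand) blast
  have Sz: "S \<subseteq> zvec N" using S(2) by (auto simp: tge_exponents_def)
  \<comment> \<open>Adding \<open>g\<close> to any exponent in \<open>S\<close> makes it
    nonnegative, so multiplication by the monomial of \<open>g\<close> brings every term into the
    domain of \<open>\<kappa>\<close>.\<close>
  define g where "g = (\<lambda>i. if i \<in> {1..N} then \<Sum>f\<in>S. \<bar>f i\<bar> else 0)"
  have g: "g \<in> zvec N" "g i \<ge> 0" for i
    by (auto simp: g_def zvec_def intro: sum_nonneg)
  have gf: "g i + f i \<ge> 0" if "f \<in> S" "i \<in> {1..N}" for f i
  proof -
    have "\<bar>f i\<bar> \<le> g i" using that member_le_sum[OF that(1) _ S(1), of "\<lambda>f. \<bar>f i\<bar>"] by (simp add: g_def)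
    then show ?thesis by simp
  qed
  let ?m = "\<lambda>f. bform N l g f" and ?gf = "\<lambda>f i. g i + f i"
  have powi: "t powi n \<in> \<T>" for n
    using Q.coeffs_powi coeffs_subset by blast
  have w: "w f \<in> \<T>" for f
    using S(3) coeffs_subset by blast
  note M_g = \<kappa>_frame_val[of x y g l, OF x y g(2)]
  have M_gf: "q.M (?gf f) \<in> \<T>" "\<kappa> (q.M (?gf f)) = e.M (?gf f)" if "f \<in> S" for f
    using \<kappa>_frame_val[of x y "?gf f" l, OF x y gf[OF that]] by blast+
  have "q.M g * a = (\<Sum>f\<in>S. w f * (t powi ?m f * q.M (?gf f)))"
    unfolding S(4) sum_distrib_left
  proof (intro sum.cong refl)
    fix f assume "f \<in> S"
    have "q.M g * (w f * q.M f) = w f * (q.M g * q.M f)"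
      using Q.coeffs_central[OF S(3), of "q.M g" f] by (metis mult.assoc)
    then show "q.M g * (w f * q.M f) = w f * (t powi ?m f * q.M (?gf f))"
      using Q.frame_mult[OF q.frame_M g(1), of f] Sz \<open>f \<in> S\<close> by auto
  qed
  then have "\<kappa> (q.M g * a) = (\<Sum>f\<in>S. \<kappa> (w f * (t powi ?m f * q.M (?gf f))))"
    using w powi M_gf by (simp add: \<kappa>_sum Tge_mult)
  also have "\<dots> = (\<Sum>f\<in>S. \<kappa> (w f) * z powi ?m f * e.M (?gf f))"
    using w powi M_gf by (intro sum.cong refl) (simp add: \<kappa>_mult \<kappa>_t_powi Tge_mult mult.assoc)
  finally have sum0: "(\<Sum>f\<in>S. \<kappa> (w f) * z powi ?m f * e.M (?gf f)) = 0"
    using \<kappa>_mult[OF M_g(1) a(2)] a(3) by simp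
  \<comment> \<open>Translation by \<open>g\<close> is injective, so the specialised relation
    involves distinct monomials of the root of unity seed and independence there applies;
    \<open>?r\<close> undoes the translation.\<close>
  have w0: "\<kappa> (w f) = 0" if "f \<in> S" for f
  proof -
    let ?r = "\<lambda>h i. h i - g i :: int"
    have inj: "inj_on ?gf S"
      by (rule inj_on_inverseI[of _ ?r]) simp
    have "(\<Sum>h\<in>?gf ` S. \<kappa> (w (?r h)) * z powi ?m (?r h) * e.M h) = 0"
      unfolding sum.reindex[OF inj] using sum0 by simp
    then have "\<kappa> (w (?r (?gf f))) * z powi ?m (?r (?gf f)) = 0"
    proof (rule E.independentD[OF e.indep, rotated 3])
      show "?gf ` S \<subseteq> zvec N" using Sz g(1) by (auto intro: zvec_add)
      show "\<kappa> (w (?r h)) * z powi ?m (?r h) \<in> E.coeffs" for h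
        by (intro subring_gen.mult E.coeffs_powi \<kappa>_coeffs S(3))
    qed (use S(1) that in auto)
    then show ?thesis using E.c_nonzero by simp
  qed
  have "\<forall>f. \<exists>v. f \<in> S \<longrightarrow> v \<in> Q.coeffs \<and> w f = \<Phi> * v"
    using coeffs_kernel[OF S(3) w0] by blast
  from choice[OF this] obtain v where v: "\<forall>f. f \<in> S \<longrightarrow> v f \<in> Q.coeffs \<and> w f = \<Phi> * v f" by (rule exE)
  have "(\<Sum>f\<in>S. v f * q.M f) \<in> Q.mono_span q.M (tge_exponents N ex iv)"
    using v S(2) by (intro Q.mono_span_sum Q.mono_span_term) auto
  moreover have "a = \<Phi> * (\<Sum>f\<in>S. v f * q.M f)"
    unfolding S(4) sum_distrib_left using v by (intro sum.cong refl) (simp add: mult.assoc)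
  ultimately show ?thesis
    using q.Tge_eq_mono_span[OF iv_subset] by blast
qed

text \<open>In each seed the quotient found by \<open>Tge_kernel\<close> coincides with the initial
  \<open>b\<close> after cancelling \<open>\<Phi>\<close>, so a single \<open>b\<close> lies in all
  mixed tori.\<close>

lemma clalg_kernel: "{a \<in> \<A>. \<kappa> a = 0} = {\<Phi> * b | b. b \<in> \<A>}"
proof (intro equalityI subsetI)
  fix a assume "a \<in> {\<Phi> * b | b. b \<in> \<A>}"
  then obtain b where b: "a = \<Phi> * b" "b \<in> \<A>" by blast
  have "Q.coeffs \<subseteq> \<A>"
    unfolding clalg_def by (rule subring_gen_least) (auto intro: subring_gen.gen)
  then have "a \<in> \<A>"
    using b \<Phi>_coeffs unfolding clalg_def by (auto intro: subring_gen.mult)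
  moreover have "a \<in> {a \<in> \<T>. \<kappa> a = 0}"
    unfolding kernel using b \<A>_subset by blast
  ultimately show "a \<in> {a \<in> \<A>. \<kappa> a = 0}" by blast
next
  fix a assume "a \<in> {a \<in> \<A>. \<kappa> a = 0}"
  then have a: "a \<in> \<A>" "a \<in> \<T>" "\<kappa> a = 0" using \<A>_subset by auto
  then have "a \<in> {\<Phi> * b | b. b \<in> \<T>}" unfolding kernel[symmetric] by blast
  then obtain b where b: "a = \<Phi> * b" "b \<in> \<T>" by blast
  show "a \<in> {\<Phi> * b | b. b \<in> \<A>}"
  \<comment> \<open>If \<open>\<Phi>\<close> is zero there is nothing to cancel, but then
    \<open>a\<close> is zero as well and 0 is a quotient in \<open>\<A>\<close>.\<close>
  proof (cases "\<Phi> = 0")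
    case True
    have "0 \<in> \<A>" unfolding clalg_def by (rule subring_gen_zero)
    moreover have "a = \<Phi> * 0" using True b by simp
    ultimately show ?thesis by blast
  next
    case False
    have "b \<in> Tge N t ex iv (fst s)" if s: "s \<in> seeds N t ex (xq, lam, B)" for s
    proof -
      have "a \<in> Tge N t ex iv (fst s)"
        using a(1) s unfolding clalg_eq_upper upper_def by blast
      moreover have "(fst s, fst (snd s), snd (snd s)) \<in> seeds N t ex (xq, lam, B)"
        using s by simp
      ultimately obtain a' where "a' \<in> Tge N t ex iv (fst s)" "a = \<Phi> * a'"
        using Tge_kernel a(2,3) by blast
      then show ?thesis using b(1) False by simp
    qed
    then have "b \<in> \<A>" unfolding clalg_eq_upper upper_def by blast
    then show ?thesis using b(1) by blast
  qed
qed

end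

end

text \<open>Image and kernel together express the isomorphism: the restriction of
  \<open>\<kappa>\<close> maps onto the root of unity cluster algebra with kernel generated by the
  cyclotomic element, so it is the quotient map up to the induced isomorphism.\<close>

theorem theorem5p11:
  fixes ell N :: nat and ex iv :: "nat set"
    and B lam :: "nat \<Rightarrow> nat \<Rightarrow> int" and d :: "nat \<Rightarrow> int"
    and z :: "'e::{division_ring, ring_char_0}" and M :: "(nat \<Rightarrow> int) \<Rightarrow> 'e"
    and t :: "'q::division_ring" and Xq :: "(nat \<Rightarrow> int) \<Rightarrow> 'q"
    and \<kappa> :: "'q \<Rightarrow> 'e"
  assumes ell_pos: "ell > 0"
    and z_root: "z ^ ell = 1" and z_prim: "\<forall>k. 0 < k \<and> k < ell \<longrightarrow> z ^ k \<noteq> 1"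
    and z_central: "central z"
    and ex_sub: "ex \<subseteq> {1..N}"
    and inv_sub: "iv \<subseteq> {1..N} - ex"
    and lam_skew: "skew_int N lam"
    and M_frame: "eps_toric_frame N z lam M"
    and ell_compat: "ell_compatible ell N ex B lam d"
    and strict: "compatible N ex B lam d"
    and t_central: "central t"
    and Xq_frame: "q_toric_frame N t lam Xq"
    and \<kappa>_add: "\<forall>a\<in>Tge N t ex iv (\<lambda>i. Xq (unitv i)). \<forall>b\<in>Tge N t ex iv (\<lambda>i. Xq (unitv i)).
                    \<kappa> (a + b) = \<kappa> a + \<kappa> b \<and> \<kappa> (a * b) = \<kappa> a * \<kappa> b"
    and \<kappa>_one: "\<kappa> 1 = 1" and \<kappa>_t: "\<kappa> t = z" and \<kappa>_tinv: "\<kappa> (inverse t) = inverse z"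
    and \<kappa>_X: "\<forall>f\<in>zvec N. (\<forall>i\<in>{1..N} - (ex \<union> iv). f i \<ge> 0) \<longrightarrow> \<kappa> (Xq f) = M f"
    and \<kappa>_surj: "\<kappa> ` Tge N t ex iv (\<lambda>i. Xq (unitv i)) = Tge N z ex iv (\<lambda>i. M (unitv i))"
    and \<kappa>_ker: "{a \<in> Tge N t ex iv (\<lambda>i. Xq (unitv i)). \<kappa> a = 0}
                 = {ipoly (cyclotomic ell) t * b | b. b \<in> Tge N t ex iv (\<lambda>i. Xq (unitv i))}"
    and A_eq_U: "clalg N t ex iv (\<lambda>i. Xq (unitv i), lam, B) = upper N t ex iv (\<lambda>i. Xq (unitv i), lam, B)"
  shows "\<kappa> ` clalg N t ex iv (\<lambda>i. Xq (unitv i), lam, B) = clalg N z ex iv (\<lambda>i. M (unitv i), lam, B)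
       \<and> {a \<in> clalg N t ex iv (\<lambda>i. Xq (unitv i), lam, B). \<kappa> a = 0}
           = {ipoly (cyclotomic ell) t * b | b. b \<in> clalg N t ex iv (\<lambda>i. Xq (unitv i), lam, B)}"
proof -
  have "z \<noteq> 0"
    using z_root ell_pos by (auto simp: power_0_left)
  interpret seed_specialization t z N ex d "\<lambda>i. Xq (unitv i)" "\<lambda>i. M (unitv i)" lam B iv \<kappa>
  proof (intro seed_specialization.intro seed_specialization_axioms.intro)
    show "cluster_seed t N ex d (\<lambda>i. Xq (unitv i)) lam B"
      by (intro toric_frame_cluster_seed t_central q_toric_frame_nonzero[OF Xq_frame] ex_sub lam_skew strict
          q_toric_frame_imp_eps_toric_frame Xq_frame)
    show "cluster_seed z N ex d (\<lambda>i. M (unitv i)) lam B"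
      by (intro toric_frame_cluster_seed z_central \<open>z \<noteq> 0\<close> ex_sub lam_skew strict M_frame)
    show "iv \<subseteq> {1..N}" using inv_sub by blast
    show "\<kappa> (Xq (unitv i)) = M (unitv i)" if "i \<in> {1..N}" for i
      using \<kappa>_X zvec_unitv[OF that] by (simp add: unitv_def)
  qed (use \<kappa>_add \<kappa>_one \<kappa>_t A_eq_U in auto)
  \<comment> \<open>The value of an integer polynomial at \<open>t\<close> lies in the coefficient
    ring, so it may serve as \<open>\<Phi>\<close>.\<close>
  show ?thesis
    using image_clalg clalg_kernel[OF subring_gen_ipoly \<kappa>_ker] by (auto intro: subring_gen.gen)
qed

end
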